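(* Let $V$ be a vector space with a diagonal braiding as in the context. For every integer $m\geq 2$, let $R^m=\langle \mathrm{Con}^R_{\leq m}\rangle_{\mathrm{ideal}}\cap T^m(V)$, where $\langle \mathrm{Con}^R_{\leq m}\rangle_{\mathrm{ideal}}$ is the two-sided ideal of $T(V)$ generated by all right constants of degree between $2$ and $m$. Then $R^m=\ker(S_m: T^m(V)\to T^m(V))$.
   Context: $\mathbb{K}$ is a field of characteristic $0$. $V$ is a $\mathbb{K}$-vector space with basis $v_1,\dots,v_N$ and diagonal braiding $\sigma(v_i\otimes v_j)=q_{ij}\,v_j\otimes v_i$, where $q_{ij}\in\mathbb{K}^\times$. $T(V)=\bigoplus_{n\ge0}V^{\otimes n}$ is the tensor algebra (concatenation product), $T^n(V)=V^{\otimes n}$. The braid group $\mathfrak{B}_n$ (generators $\sigma_1,\dots,\sigma_{n-1}$) acts on $V^{\otimes n}$ by $\sigma_i\mapsto \mathrm{id}^{\otimes(i-1)}\otimes\sigma\otimes\mathrm{id}^{\otimes(n-i-1)}$; products act by composition (rightmost factor first). Total symmetrization operator: $S_n=\sum_{w\in\mathfrak{S}_n}T_w\in\mathbb{K}[\mathfrak{B}_n]$, where $T_w=\sigma_{i_1}\cdots\sigma_{i_r}$ for any reduced expression $w=s_{i_1}\cdots s_{i_r}$. Right differential element: $T_n=1+\sigma_{n-1}+\sigma_{n-1}\sigma_{n-2}+\cdots+\sigma_{n-1}\sigma_{n-2}\cdots\sigma_1$. An element $x\in T^n(V)$ is a right constant of degree $n$ if $T_nx=0$; $\mathrm{Con}^R_n$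 is the space of these and $\mathrm{Con}^R_{\leq m}=\mathrm{span}\left(\bigcup_{2\leq n\leq m}\mathrm{Con}^R_n\right)$. *)

theory Defs
  imports
    "HOL-Library.Poly_Mapping"
    "HOL-Combinatorics.Permutations"
    "HOL-Algebra.Ideal"
    "HOL-Algebra.Algebraic_Closure_Type"
begin

text \<open>Lists form the free monoid under concatenation. Hence, for \<open>V\<close> with basis indexed by \<open>'i\<close>,
  the type \<open>'i list \<Rightarrow>\<^sub>0 'k\<close> with its convolution product is the tensor algebra of \<open>V\<close>:
  the list \<open>[i\<^sub>1, \<dots>, i\<^sub>n]\<close> stands for the basis tensor \<open>v\<^bsub>i\<^sub>1\<^esub> \<otimes> \<dots> \<otimes> v\<^bsub>i\<^sub>n\<^esub>\<close>.\<close>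

instantiation list :: (type) monoid_add
begin

definition zero_list :: "'a list" where "zero_list = []"

definition plus_list :: "'a list \<Rightarrow> 'a list \<Rightarrow> 'a list" where "plus_list u v = u @ v"

instance
  by standard (simp_all add: zero_list_def plus_list_def)

end

type_synonym ('i, 'k) tensor = "'i list \<Rightarrow>\<^sub>0 'k"

abbreviation basis_tensor :: "'i list \<Rightarrow> ('i, 'k::field) tensor" where
  "basis_tensor w \<equiv> Poly_Mapping.single w 1"

definition tscale :: "'k::field \<Rightarrow> ('i, 'k) tensor \<Rightarrow> ('i, 'k) tensor" where
  "tscale c x = Poly_Mapping.map ((*) c) x"

lemma lookup_tscale:
  "Poly_Mapping.lookup (tscale c x) w = c * Poly_Mapping.lookup x w"
  by (simp add: tscale_def Poly_Mapping.map.rep_eq when_def)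

interpretation tensor: vector_space "tscale :: 'k::field \<Rightarrow> ('i, 'k) tensor \<Rightarrow> ('i, 'k) tensor"
  by unfold_locales (auto simp: lookup_tscale lookup_add algebra_simps intro!: poly_mapping_eqI)

definition linear_ext :: "('i list \<Rightarrow> ('i, 'k::field) tensor) \<Rightarrow> ('i, 'k) tensor \<Rightarrow> ('i, 'k) tensor"
  where "linear_ext f x = (\<Sum>w\<in>Poly_Mapping.keys x. tscale (Poly_Mapping.lookup x w) (f w))"

definition tensor_power :: "nat \<Rightarrow> ('i, 'k::field) tensor set" where
  "tensor_power n = {x. \<forall>w\<in>Poly_Mapping.keys x. length w = n}"


text \<open>The diagonal braiding is an endomorphism of \<open>V \<otimes> V\<close>; it is extended by zero to the other
  degrees, where it is never used.\<close>

definition braiding :: "('i \<Rightarrow> 'i \<Rightarrow> 'k::field) \<Rightarrow> ('i, 'k) tensor \<Rightarrow> ('i, 'k) tensor" where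
  "braiding q = linear_ext (\<lambda>w. case w of
      [i, j] \<Rightarrow> tscale (q i j) (basis_tensor [j, i])
    | _ \<Rightarrow> 0)"

text \<open>\<open>braid_gen q k\<close> is the action of the \<open>k\<close>-th braid generator: on tensors of degree \<open>n\<close>, for
  \<open>1 \<le> k < n\<close>, it is \<open>id\<^bsup>\<otimes>(k-1)\<^esup> \<otimes> \<sigma> \<otimes> id\<^bsup>\<otimes>(n-k-1)\<^esup>\<close>. The braiding applies to the letters
  \<open>k\<close> and \<open>k + 1\<close>, which have list indices \<open>k - 1\<close> and \<open>k\<close>.\<close>

definition braid_gen :: "('i \<Rightarrow> 'i \<Rightarrow> 'k::field) \<Rightarrow> nat \<Rightarrow> ('i, 'k) tensor \<Rightarrow> ('i, 'k) tensor" where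
  "braid_gen q k = linear_ext (\<lambda>w.
      basis_tensor (take (k - 1) w)
      * braiding q (basis_tensor (take 2 (drop (k - 1) w)))
      * basis_tensor (drop (k + 1) w))"

text \<open>The list \<open>[i\<^sub>1, \<dots>, i\<^sub>r]\<close> acts as \<open>\<sigma>\<^bsub>i\<^sub>1\<^esub> \<cdots> \<sigma>\<^bsub>i\<^sub>r\<^esub>\<close>, the last factor being applied first.\<close>

definition braid_act :: "('i \<Rightarrow> 'i \<Rightarrow> 'k::field) \<Rightarrow> nat list \<Rightarrow> ('i, 'k) tensor \<Rightarrow> ('i, 'k) tensor" where
  "braid_act q ks = foldr (braid_gen q) ks"


definition perm_of_word :: "nat list \<Rightarrow> nat \<Rightarrow> nat" where
  "perm_of_word ks = foldr (\<lambda>k p. transpose k (k + 1) \<circ> p) ks id"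

definition is_expression :: "nat \<Rightarrow> nat list \<Rightarrow> (nat \<Rightarrow> nat) \<Rightarrow> bool" where
  "is_expression n ks w \<longleftrightarrow> set ks \<subseteq> {1..<n} \<and> perm_of_word ks = w"

definition is_reduced_expression :: "nat \<Rightarrow> nat list \<Rightarrow> (nat \<Rightarrow> nat) \<Rightarrow> bool" where
  "is_reduced_expression n ks w \<longleftrightarrow>
     is_expression n ks w \<and> (\<forall>js. is_expression n js w \<longrightarrow> length ks \<le> length js)"

text \<open>By Matsumoto's theorem and the braid relations, the operator \<open>T\<^sub>w\<close> does not depend on the
  reduced expression selected here.\<close>

definition perm_op ::
  "('i \<Rightarrow> 'i \<Rightarrow> 'k::field) \<Rightarrow> nat \<Rightarrow> (nat \<Rightarrow> nat) \<Rightarrow> ('i, 'k) tensor \<Rightarrow> ('i, 'k) tensor" where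
  "perm_op q n w = braid_act q (SOME ks. is_reduced_expression n ks w)"

definition total_symm :: "('i \<Rightarrow> 'i \<Rightarrow> 'k::field) \<Rightarrow> nat \<Rightarrow> ('i, 'k) tensor \<Rightarrow> ('i, 'k) tensor" where
  "total_symm q n x = (\<Sum>w | w permutes {1..n}. perm_op q n w x)"

text \<open>The summand for \<open>k\<close> is \<open>\<sigma>\<^bsub>n-1\<^esub> \<sigma>\<^bsub>n-2\<^esub> \<cdots> \<sigma>\<^sub>k\<close>, and it is the identity for \<open>k = n\<close>.\<close>

definition right_diff :: "('i \<Rightarrow> 'i \<Rightarrow> 'k::field) \<Rightarrow> nat \<Rightarrow> ('i, 'k) tensor \<Rightarrow> ('i, 'k) tensor" where
  "right_diff q n x = (\<Sum>k = 1..n. braid_act q (rev [k..<n]) x)"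

definition right_constants :: "('i \<Rightarrow> 'i \<Rightarrow> 'k::field) \<Rightarrow> nat \<Rightarrow> ('i, 'k) tensor set" where
  "right_constants q n = {x \<in> tensor_power n. right_diff q n x = 0}"

definition right_constants_upto :: "('i \<Rightarrow> 'i \<Rightarrow> 'k::field) \<Rightarrow> nat \<Rightarrow> ('i, 'k) tensor set" where
  "right_constants_upto q m = tensor.span (\<Union>n\<in>{2..m}. right_constants q n)"

definition R_part :: "('i \<Rightarrow> 'i \<Rightarrow> 'k::field) \<Rightarrow> nat \<Rightarrow> ('i, 'k) tensor set" where
  "R_part q m = genideal ring_of_type_algebra (right_constants_upto q m) \<inter> tensor_power m"

end

theory Submission
  imports Defs
begin

text \<open>Write \<open>T\<close> for the tensor algebra and \<open>v\<^sub>i\<close> for its letters. The argument runs on the right skew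
derivations \<open>\<partial>\<^sub>i\<close>, which satisfy \<open>\<partial>\<^sub>i (x v\<^sub>j) = [i = j] x + q\<^sub>i\<^sub>j \<partial>\<^sub>i(x) v\<^sub>j\<close>. They are the components of
the right differential operator, \<open>T\<^sub>n x = \<Sum>\<^sub>i \<partial>\<^sub>i(x) v\<^sub>i\<close> (\<open>right_diff_eq_sum_partial\<close>), so that a right
constant is a tensor killed by every \<open>\<partial>\<^sub>i\<close>.

The elements \<open>\<sigma>\<^bsub>n-1\<^esub> \<cdots> \<sigma>\<^sub>k\<close> are the lifts of the minimal representatives of the cosets of
\<open>\<SS>\<^bsub>n-1\<^esub>\<close> in \<open>\<SS>\<^sub>n\<close>, which gives the factorization \<open>S\<^sub>n = (S\<^bsub>n-1\<^esub> \<otimes> id) T\<^sub>n\<close> (\<open>total_symm_Suc\<close>).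
Hence \<open>S\<^sub>n x = 0\<close> if and only if every product of \<open>n\<close> skew derivations kills \<open>x\<close>
(\<open>total_symm_eq_0_iff\<close>), and the theorem becomes a statement about skew derivations only.

The tensors \<open>x\<close> for which no product of skew derivations of any length has a constant term at \<open>x\<close>
form a two-sided ideal, by the Leibniz rule (\<open>ideal_derivation_radical\<close>). It contains the right
constants of positive degree, and this yields \<open>R\<^sup>m \<subseteq> ker S\<^sub>m\<close>.

For the converse, suppose that all products of \<open>r + 1\<close> skew derivations kill \<open>x\<close>, of degree \<open>n > r\<close>.
Then the tensors \<open>\<partial>\<^sub>u x\<close>, for \<open>u\<close> a word of length \<open>r\<close>, are right constants of degree \<open>n - r\<close>. Left
multiplication by a constant \<open>k\<close> commutes with all \<open>\<partial>\<^sub>i\<close>, hence \<open>\<partial>\<^sub>u (\<Sum>\<^sub>w k\<^sub>w w) = \<Sum>\<^sub>w M\<^sub>u\<^sub>w k\<^sub>w\<close>, where the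
scalar \<open>M\<^sub>u\<^sub>w\<close> is \<open>\<partial>\<^sub>u w\<close> and \<open>w\<close> ranges over the words of length \<open>r\<close>. If constants \<open>k\<^sub>w\<close> with
\<open>\<Sum>\<^sub>w M\<^sub>u\<^sub>w k\<^sub>w = \<partial>\<^sub>u x\<close> for all \<open>u\<close> exist, then subtracting \<open>\<Sum>\<^sub>w k\<^sub>w w\<close>, which lies in the ideal of the
constants, leaves a tensor killed by all products of \<open>r\<close> skew derivations; going down from \<open>r = m\<close>
to \<open>r = 0\<close> puts \<open>x\<close> into the ideal.
The linear system is solvable over \<open>T\<close> because the coproduct of \<open>x\<close> provides tensors \<open>a\<^sub>w\<close> with
\<open>\<partial>\<^sub>u x = \<Sum>\<^sub>w M\<^sub>u\<^sub>w a\<^sub>w\<close> (\<open>partials_factor\<close>). A matrix \<open>g\<close> with \<open>M g M = M\<close>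
(\<open>matrix_generalized_inverse\<close>) then turns this into the solution \<open>k\<^sub>w = \<Sum>\<^sub>u g\<^sub>w\<^sub>u \<partial>\<^sub>u x\<close>, a combination of
constants (\<open>constant_expansion\<close>). The argument uses multiplication of constants by words from
the right only; thus the kernels of the \<open>S\<^sub>n\<close>, which make up the defining ideal of the Nichols algebra,
already form the right ideal generated by the constants of positive degree.\<close>

section \<open>Linear maps on the tensor algebra\<close>

abbreviation tlinear :: "(('i, 'k::field) tensor \<Rightarrow> ('i, 'k) tensor) \<Rightarrow> bool" where
  "tlinear \<equiv> Vector_Spaces.linear tscale tscale"

abbreviation words :: "nat \<Rightarrow> 'i list set" where
  "words n \<equiv> {w. length w = n}"

abbreviation letter :: "'i \<Rightarrow> ('i, 'k::field) tensor" where
  "letter j \<equiv> basis_tensor [j]"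

lemma finite_words [simp]: "finite (words n :: 'i::finite list set)"
  using finite_lists_length_eq[of "UNIV :: 'i set" n] by simp

lemma tlinearI:
  assumes "\<And>x y. f (x + y) = f x + f y" "\<And>c x. f (tscale c x) = tscale c (f x)"
  shows "tlinear f"
  using assms by unfold_locales auto

lemma tlinear_add: "tlinear f \<Longrightarrow> f (x + y) = f x + f y"
  and tlinear_scale: "tlinear f \<Longrightarrow> f (tscale c x) = tscale c (f x)"
  by (simp_all add: linear_iff_module_hom module_hom.add module_hom.scale)

lemma tlinear_zero: "tlinear f \<Longrightarrow> f 0 = 0"
  and tlinear_diff: "tlinear f \<Longrightarrow> f (x - y) = f x - f y"
  and tlinear_sum: "tlinear f \<Longrightarrow> f (sum g A) = (\<Sum>a\<in>A. f (g a))"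
  by (simp_all add: linear_iff_module_hom module_hom.zero module_hom.diff module_hom.sum)

lemma tlinear_id: "tlinear (\<lambda>x. x)"
  and tlinear_comp: "tlinear f \<Longrightarrow> tlinear g \<Longrightarrow> tlinear (\<lambda>x. f (g x))"
  and tlinear_plus: "tlinear f \<Longrightarrow> tlinear g \<Longrightarrow> tlinear (\<lambda>x. f x + g x)"
  and tlinear_tscale: "tlinear f \<Longrightarrow> tlinear (\<lambda>x. tscale c (f x))"
  by (auto intro!: tlinearI simp: tlinear_add tlinear_scale tensor.scale_right_distrib mult.commute)

lemma tlinear_setsum: "(\<And>a. a \<in> A \<Longrightarrow> tlinear (f a)) \<Longrightarrow> tlinear (\<lambda>x. \<Sum>a\<in>A. f a x)"
  by (auto intro!: tlinearI simp: tlinear_add tlinear_scale sum.distrib tensor.scale_sum_right)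

lemma linear_ext_eq_sum:
  assumes "finite A" "Poly_Mapping.keys x \<subseteq> A"
  shows "linear_ext f x = (\<Sum>w\<in>A. tscale (Poly_Mapping.lookup x w) (f w))"
  unfolding linear_ext_def using assms
  by (intro sum.mono_neutral_left) (auto simp: in_keys_iff)

lemma tlinear_linear_ext:
  fixes f :: "'i list \<Rightarrow> ('i, 'k::field) tensor"
  shows "tlinear (linear_ext f)"
proof (rule tlinearI)
  fix x y :: "('i, 'k) tensor" and c :: 'k
  let ?A = "Poly_Mapping.keys x \<union> Poly_Mapping.keys y"
  have "Poly_Mapping.keys (x + y) \<subseteq> ?A" by (rule keys_add)
  then show "linear_ext f (x + y) = linear_ext f x + linear_ext f y"
    by (simp add: linear_ext_eq_sum[of ?A] lookup_add tensor.scale_left_distrib sum.distrib)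
  have "Poly_Mapping.keys (tscale c x) \<subseteq> Poly_Mapping.keys x"
    by (auto simp: in_keys_iff lookup_tscale)
  then show "linear_ext f (tscale c x) = tscale c (linear_ext f x)"
    by (simp add: linear_ext_eq_sum[of "Poly_Mapping.keys x"] lookup_tscale tensor.scale_sum_right)
qed

lemma linear_ext_basis [simp]: "linear_ext f (basis_tensor w) = f w"
  by (simp add: linear_ext_def)

lemma tscale_basis: "tscale c (basis_tensor w) = Poly_Mapping.single w c"
  by (simp add: tscale_def)

lemma tensor_expand:
  "(\<Sum>w\<in>Poly_Mapping.keys x. tscale (Poly_Mapping.lookup x w) (basis_tensor w)) = x"
  by (rule poly_mapping_eqI)
    (auto simp: lookup_sum tscale_basis lookup_single when_def in_keys_iff)

text \<open>Words form a basis, so linear statements about tensors reduce to words: by this rule in general, and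
for equations between linear maps by the equality rules after it.\<close>

lemma tensor_induct [case_names zero add basis]:
  assumes "P 0" "\<And>x y. P x \<Longrightarrow> P y \<Longrightarrow> P (x + y)" "\<And>c w. P (tscale c (basis_tensor w))"
  shows "P x"
proof -
  have "P (\<Sum>w\<in>A. tscale (Poly_Mapping.lookup x w) (basis_tensor w))" if "finite A" for A
    using that by induction (auto intro: assms)
  then show ?thesis by (metis tensor_expand finite_keys)
qed

lemma tlinear_eq_on_tensor_power:
  assumes "tlinear f" "tlinear g"
    and "\<And>w. length w = n \<Longrightarrow> f (basis_tensor w) = g (basis_tensor w)"
    and "x \<in> tensor_power n"
  shows "f x = g x"
proof -
  have "f (\<Sum>w\<in>Poly_Mapping.keys x. tscale (Poly_Mapping.lookup x w) (basis_tensor w))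
      = g (\<Sum>w\<in>Poly_Mapping.keys x. tscale (Poly_Mapping.lookup x w) (basis_tensor w))"
    using assms by (auto simp: tlinear_sum tlinear_scale tensor_power_def intro!: sum.cong)
  then show ?thesis by (simp add: tensor_expand)
qed

lemma tlinear_eq:
  assumes "tlinear f" "tlinear g" "\<And>w. f (basis_tensor w) = g (basis_tensor w)"
  shows "f x = g x"
  by (induction x rule: tensor_induct) (use assms in \<open>auto simp: tlinear_zero tlinear_add tlinear_scale\<close>)

lemma basis_append: "basis_tensor (u @ v) = basis_tensor u * basis_tensor v"
  by (simp add: mult_single plus_list_def)

lemma basis_Nil [simp]: "basis_tensor [] = 1"
  by (metis single_one zero_list_def)

lemma basis_snoc: "basis_tensor (u @ [j]) = basis_tensor u * letter j"
  by (rule basis_append)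

lemma tscale_mult_left: "tscale c x * y = tscale c (x * y)"
  by (simp add: tscale_def mult_map_scale_conv_mult mult.assoc)

lemma tscale_mult_right: "x * tscale c y = tscale c (x * y)"
proof -
  have "x * Poly_Mapping.single 0 c = Poly_Mapping.single 0 c * x"
    by (induction x rule: tensor_induct)
      (auto simp: distrib_left distrib_right tscale_basis mult_single mult.commute)
  then show ?thesis
    unfolding tscale_def mult_map_scale_conv_mult by (simp flip: mult.assoc)
qed

lemma tlinear_mult_right: "tlinear f \<Longrightarrow> tlinear (\<lambda>x. f x * y)"
  and tlinear_mult_left: "tlinear f \<Longrightarrow> tlinear (\<lambda>x. y * f x)"
  by (auto intro!: tlinearI simp: tlinear_add tlinear_scale distrib_right distrib_left
      tscale_mult_left tscale_mult_right)

lemmas tlinear_intros = tlinear_linear_ext tlinear_id tlinear_plus tlinear_tscale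
  tlinear_setsum tlinear_mult_left tlinear_mult_right

lemma tensor_power_iff:
  "x \<in> tensor_power n \<longleftrightarrow> (\<forall>w. length w \<noteq> n \<longrightarrow> Poly_Mapping.lookup x w = 0)"
  by (auto simp: tensor_power_def in_keys_iff)

lemma basis_in_tensor_power: "length w = n \<Longrightarrow> basis_tensor w \<in> tensor_power n"
  by (auto simp: tensor_power_def)

lemma tensor_power_zero: "0 \<in> tensor_power n"
  and tensor_power_add: "x \<in> tensor_power n \<Longrightarrow> y \<in> tensor_power n \<Longrightarrow> x + y \<in> tensor_power n"
  and tensor_power_diff: "x \<in> tensor_power n \<Longrightarrow> y \<in> tensor_power n \<Longrightarrow> x - y \<in> tensor_power n"
  and tensor_power_scale: "x \<in> tensor_power n \<Longrightarrow> tscale c x \<in> tensor_power n"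
  by (auto simp: tensor_power_iff lookup_add lookup_minus lookup_tscale)

lemma tensor_power_sum:
  "(\<And>a. a \<in> A \<Longrightarrow> f a \<in> tensor_power n) \<Longrightarrow> sum f A \<in> tensor_power n"
  by (auto simp: tensor_power_iff lookup_sum)

lemma tensor_power_mult:
  assumes "x \<in> tensor_power m" "y \<in> tensor_power n"
  shows "x * y \<in> tensor_power (m + n)"
  using keys_mult[of x y] assms unfolding tensor_power_def by (fastforce simp: plus_list_def)

lemma tlinear_tensor_power:
  assumes "tlinear f" "\<And>w. length w = n \<Longrightarrow> f (basis_tensor w) \<in> tensor_power m"
    and "x \<in> tensor_power n"
  shows "f x \<in> tensor_power m"
proof -
  have "f (\<Sum>w\<in>Poly_Mapping.keys x. tscale (Poly_Mapping.lookup x w) (basis_tensor w))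
      \<in> tensor_power m"
    using assms
    by (auto simp: tlinear_sum tlinear_scale tensor_power_def[of n]
        intro!: tensor_power_sum tensor_power_scale)
  then show ?thesis by (simp add: tensor_expand)
qed

lemma tensor_power_0:
  assumes "x \<in> tensor_power 0"
  shows "x = tscale (Poly_Mapping.lookup x []) 1"
  using assms by (intro poly_mapping_eqI)
    (auto simp: tensor_power_iff lookup_tscale lookup_one when_def zero_list_def)

lemma lookup_mult_letter_snoc:
  "Poly_Mapping.lookup (x * letter j) (w @ [i]) = (if i = j then Poly_Mapping.lookup x w else 0)"
  by (induction x rule: tensor_induct)
    (auto simp: distrib_right lookup_add tscale_basis mult_single plus_list_def lookup_single when_def)

lemma lookup_mult_Nil:
  fixes x y :: "('i, 'k::field) tensor"
  shows "Poly_Mapping.lookup (x * y) [] = Poly_Mapping.lookup x [] * Poly_Mapping.lookup y []"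
proof (induction x rule: tensor_induct)
  case (basis c u)
  show ?case
    by (induction y rule: tensor_induct)
      (auto simp: distrib_left lookup_add tscale_basis mult_single plus_list_def lookup_single when_def)
qed (simp_all add: distrib_right lookup_add)

text \<open>A tensor of positive degree is determined by the parts in front of its possible last letters; this
lets an equation of the form \<open>\<Sum>\<^sub>i x\<^sub>i v\<^sub>i = 0\<close> be read componentwise.\<close>

lemma sum_mult_letter_eq_0_iff:
  fixes f :: "'i::finite \<Rightarrow> ('i, 'k::field) tensor"
  shows "(\<Sum>i\<in>UNIV. f i * letter i) = 0 \<longleftrightarrow> (\<forall>i. f i = 0)"
proof
  assume *: "(\<Sum>i\<in>UNIV. f i * letter i) = 0"
  show "\<forall>i. f i = 0"
  proof (intro allI poly_mapping_eqI)
    fix i w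
    have "Poly_Mapping.lookup (\<Sum>i\<in>UNIV. f i * letter i) (w @ [i]) = Poly_Mapping.lookup (f i) w"
      by (simp add: lookup_sum lookup_mult_letter_snoc)
    then show "Poly_Mapping.lookup (f i) w = Poly_Mapping.lookup 0 w" using * by simp
  qed
qed simp

section \<open>Right skew derivations\<close>

text \<open>A right derivation meets the last letter of a word first, so the recursion runs over the reversed
word. The scalar \<open>q i j\<close> is the cost of braiding a letter \<open>i\<close> past a \<open>j\<close> on its way to the right end.\<close>

primrec partial_rev :: "('i \<Rightarrow> 'i \<Rightarrow> 'k::field) \<Rightarrow> 'i \<Rightarrow> 'i list \<Rightarrow> ('i, 'k) tensor" where
  "partial_rev q i [] = 0"
| "partial_rev q i (j # w) =
     (if i = j then basis_tensor (rev w) else 0) + tscale (q i j) (partial_rev q i w * letter j)"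

definition partial :: "('i \<Rightarrow> 'i \<Rightarrow> 'k::field) \<Rightarrow> 'i \<Rightarrow> ('i, 'k) tensor \<Rightarrow> ('i, 'k) tensor" where
  "partial q i = linear_ext (\<lambda>w. partial_rev q i (rev w))"

text \<open>The algebra endomorphism scaling the letter \<open>k\<close> by \<open>f k\<close>. With \<open>f = q i\<close> it is the twist in the
Leibniz rule of \<open>partial q i\<close>; with \<open>f = (\<lambda>i. q i j)\<close> it collects the scalars of all derivations
passing the letter \<open>j\<close>.\<close>

definition twist :: "('i \<Rightarrow> 'k::field) \<Rightarrow> ('i, 'k) tensor \<Rightarrow> ('i, 'k) tensor" where
  "twist f = linear_ext (\<lambda>w. tscale (prod_list (map f w)) (basis_tensor w))"

text \<open>The last letter of \<open>u\<close> acts first, in accordance with the composition of operators.\<close>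

definition partials :: "('i \<Rightarrow> 'i \<Rightarrow> 'k::field) \<Rightarrow> 'i list \<Rightarrow> ('i, 'k) tensor \<Rightarrow> ('i, 'k) tensor" where
  "partials q u = foldr (partial q) u"

lemma tlinear_partial: "tlinear (partial q i)"
  unfolding partial_def by (rule tlinear_linear_ext)

lemma tlinear_twist: "tlinear (twist f)"
  unfolding twist_def by (rule tlinear_linear_ext)

lemmas tlinear_skew_intros = tlinear_intros tlinear_partial tlinear_twist
  tlinear_comp[OF tlinear_partial] tlinear_comp[OF tlinear_twist]

lemma partials_Nil [simp]: "partials q [] x = x"
  and partials_Cons: "partials q (i # u) x = partial q i (partials q u x)"
  and partials_append: "partials q (u @ v) x = partials q u (partials q v x)"
  by (simp_all add: partials_def)

lemma tlinear_partials: "tlinear (partials q u)"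
proof (induction u)
  case Nil
  show ?case using tlinear_id by (simp add: partials_def id_def)
next
  case (Cons i u)
  then show ?case using tlinear_comp[OF tlinear_partial Cons] by (simp add: partials_def comp_def)
qed

lemma partial_one [simp]: "partial q i 1 = 0"
  unfolding partial_def basis_Nil[symmetric] linear_ext_basis by simp

lemma twist_basis: "twist f (basis_tensor w) = tscale (prod_list (map f w)) (basis_tensor w)"
  by (simp add: twist_def)

lemma twist_one [simp]: "twist f 1 = 1"
  unfolding basis_Nil[symmetric] twist_basis by simp

lemma partial_mult_letter:
  "partial q i (x * letter j) = (if i = j then x else 0) + tscale (q i j) (partial q i x * letter j)"
proof (rule tlinear_eq[where x = x])
  show "tlinear (\<lambda>x. (if i = j then x else 0) + tscale (q i j) (partial q i x * letter j))"
    by (cases "i = j") (auto intro!: tlinear_skew_intros)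
  show "partial q i (basis_tensor w * letter j) =
      (if i = j then basis_tensor w else 0) + tscale (q i j) (partial q i (basis_tensor w) * letter j)" for w
    by (simp add: partial_def flip: basis_snoc)
qed (intro tlinear_skew_intros)+

lemma twist_mult_letter: "twist f (x * letter j) = tscale (f j) (twist f x * letter j)"
proof (rule tlinear_eq[where x = x])
  show "twist f (basis_tensor w * letter j) =
    tscale (f j) (twist f (basis_tensor w) * letter j)" for w
    by (simp add: twist_def tscale_mult_left mult.commute flip: basis_snoc)
qed (intro tlinear_skew_intros)+

text \<open>The Leibniz rule. In the second summand \<open>\<partial>\<^sub>i\<close> takes its letter from \<open>x\<close> and has braided it past all
of \<open>y\<close>. In particular \<open>\<partial>\<^sub>i\<close> commutes with left multiplication by anything it kills.\<close>

lemma partial_mult: "partial q i (x * y) = x * partial q i y + partial q i x * twist (q i) y"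
proof (rule tlinear_eq[where x = y])
  show "partial q i (x * basis_tensor w)
      = x * partial q i (basis_tensor w) + partial q i x * twist (q i) (basis_tensor w)" for w
  proof (induction w rule: rev_induct)
    case Nil
    show ?case by simp
  next
    case (snoc j w)
    have "partial q i (x * basis_tensor (w @ [j])) = partial q i (x * basis_tensor w * letter j)"
      by (simp only: basis_snoc mult.assoc)
    then show ?case
      by (simp add: partial_mult_letter twist_mult_letter basis_snoc snoc tscale_mult_left
          tscale_mult_right tensor.scale_right_distrib distrib_left distrib_right flip: mult.assoc)
  qed
qed (intro tlinear_skew_intros)+

text \<open>Since \<open>\<partial>\<^sub>k\<close> removes one letter \<open>k\<close>, it loses one factor \<open>f k\<close> of the scaling.\<close>

lemma partial_twist: "partial q k (twist f x) = tscale (f k) (twist f (partial q k x))"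
proof (rule tlinear_eq[where x = x])
  show "tlinear (\<lambda>x. partial q k (twist f x))" "tlinear (\<lambda>x. tscale (f k) (twist f (partial q k x)))"
    by (intro tlinear_skew_intros)+
  fix w :: "'a list"
  show "partial q k (twist f (basis_tensor w)) = tscale (f k) (twist f (partial q k (basis_tensor w)))"
  proof (induction w rule: rev_induct)
    case (snoc j w)
    then show ?case
      by (auto simp: basis_snoc twist_mult_letter partial_mult_letter tlinear_scale[OF tlinear_partial]
          tlinear_scale[OF tlinear_twist] tlinear_add[OF tlinear_twist] tlinear_zero[OF tlinear_twist]
          tscale_mult_left tensor.scale_right_distrib mult.commute)
  qed (simp add: tlinear_zero[OF tlinear_twist])
qed

lemma partials_twist: "partials q u (twist f x) = tscale (prod_list (map f u)) (twist f (partials q u x))"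
  by (induction u) (simp_all add: partials_Cons tlinear_scale[OF tlinear_partial] partial_twist mult.commute)

lemma lookup_twist_Nil: "Poly_Mapping.lookup (twist f x) [] = Poly_Mapping.lookup x []"
proof (induction x rule: tensor_induct)
  case (basis c w)
  then show ?case
    unfolding tlinear_scale[OF tlinear_twist] twist_basis
    by (cases w) (simp_all add: lookup_tscale lookup_single)
qed (simp_all add: tlinear_zero[OF tlinear_twist] tlinear_add[OF tlinear_twist] lookup_add)

lemma partial_in_tensor_power:
  assumes "x \<in> tensor_power n"
  shows "partial q i x \<in> tensor_power (n - 1)"
proof (rule tlinear_tensor_power[OF tlinear_partial _ assms])
  fix w :: "'a list" assume "length w = n"
  then show "partial q i (basis_tensor w) \<in> tensor_power (n - 1)"
  proof (induction w arbitrary: n rule: rev_induct)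
    case (snoc j w)
    have "partial q i (basis_tensor w) * letter j \<in> tensor_power (length w)"
    proof (cases w)
      case (Cons a v)
      then have "length w - 1 + 1 = length w" by simp
      then show ?thesis using tensor_power_mult[OF snoc.IH[OF refl], of "letter j" 1]
        by (simp add: basis_in_tensor_power)
    qed (simp add: tensor_power_zero)
    then show ?case using snoc.prems
      by (auto simp: basis_snoc partial_mult_letter tensor_power_zero
          intro!: tensor_power_add tensor_power_scale basis_in_tensor_power)
  qed (simp add: tensor_power_zero)
qed

lemma partials_in_tensor_power:
  "x \<in> tensor_power n \<Longrightarrow> partials q u x \<in> tensor_power (n - length u)"
proof (induction u)
  case (Cons i u)
  show ?case using partial_in_tensor_power[OF Cons.IH[OF Cons.prems]]
    by (simp add: partials_Cons)
qed simp

section \<open>Reduced expressions and inversions\<close>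

lemma perm_of_word_Nil [simp]: "perm_of_word [] = id"
  and perm_of_word_Cons: "perm_of_word (k # ks) = transpose k (k + 1) \<circ> perm_of_word ks"
  by (simp_all add: perm_of_word_def)

lemma perm_of_word_append: "perm_of_word (ks @ js) = perm_of_word ks \<circ> perm_of_word js"
  by (induction ks) (simp_all add: perm_of_word_Cons comp_assoc)

lemma perm_of_word_rev_left [simp]: "perm_of_word (rev ks) (perm_of_word ks a) = a"
  by (induction ks arbitrary: a) (simp_all add: perm_of_word_Cons perm_of_word_append)

lemma perm_of_word_rev_right [simp]: "perm_of_word ks (perm_of_word (rev ks) a) = a"
  using perm_of_word_rev_left[of "rev ks"] by simp

lemma perm_of_word_rev_eq: "perm_of_word (rev ks) = inv_into UNIV (perm_of_word ks)"
  by (rule inv_equality[symmetric]) simp_all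

lemma perm_of_word_permutes: "set ks \<subseteq> {1..<n} \<Longrightarrow> perm_of_word ks permutes {1..n}"
proof (induction ks)
  case (Cons k ks)
  then have "perm_of_word ks permutes {1..n}" "transpose k (k + 1) permutes {1..n}"
    by (auto intro: permutes_swap_id)
  then show ?case by (simp only: perm_of_word_Cons permutes_compose)
qed (simp add: permutes_id[unfolded id_def] id_def)

text \<open>Pairs of positions, with no bound on their size: this makes the length of a permutation independent
of the symmetric group that it is considered in.\<close>

definition inversions :: "(nat \<Rightarrow> nat) \<Rightarrow> (nat \<times> nat) set" where
  "inversions p = {(a, b). a < b \<and> p b < p a}"

text \<open>Multiplying a permutation \<open>p\<close> on the left by the transposition \<open>(k k+1)\<close> adds an inversion exactly
if \<open>p\<inverse> k < p\<inverse> (k + 1)\<close>, and the reversed word represents \<open>p\<inverse>\<close>. An expression is thus ascending if each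
of its letters adds an inversion. These are the reduced expressions, but unlike minimality of the length,
this recursive condition can be used in inductions.\<close>

primrec ascending :: "nat list \<Rightarrow> bool" where
  "ascending [] = True"
| "ascending (k # ks) \<longleftrightarrow>
     ascending ks \<and> perm_of_word (rev ks) k < perm_of_word (rev ks) (k + 1)"

lemma inversions_id [simp]: "inversions (\<lambda>a. a) = {}"
  by (auto simp: inversions_def)

text \<open>Exchanging the values \<open>k\<close> and \<open>k + 1\<close> alters only the relative order of the two positions
where they occur.\<close>

lemma inversions_transpose_comp:
  assumes ia: "\<And>a. r (p a) = a" and ri: "\<And>a. p (r a) = a" and lt: "r k < r (k + 1)"
  shows "inversions (transpose k (k + 1) \<circ> p) = insert (r k, r (k + 1)) (inversions p)"
    and "(r k, r (k + 1)) \<notin> inversions p"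
proof -
  show "(r k, r (k + 1)) \<notin> inversions p" by (simp add: inversions_def ri)
  \<comment> \<open>The values \<open>k\<close> and \<open>k + 1\<close> sit at the positions \<open>r k\<close> and \<open>r (k + 1)\<close>.\<close>
  have pk: "p a = k \<longleftrightarrow> a = r k" "p a = Suc k \<longleftrightarrow> a = r (Suc k)" for a using ia ri by metis+
  have "(a < b \<and> transpose k (k + 1) (p b) < transpose k (k + 1) (p a)) \<longleftrightarrow>
     (a = r k \<and> b = r (k + 1)) \<or> (a < b \<and> p b < p a)" for a b
  proof -
    have inj: "p a = p b \<longleftrightarrow> a = b" using ia by metis
    have 1: "a = r k \<and> b = r (k + 1) \<longleftrightarrow> p a = k \<and> p b = Suc k" using pk by auto
    have 2: "a < b" if "p a = k" "p b = Suc k" using that pk lt by auto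
    have 3: "b < a" if "p b = k" "p a = Suc k" using that pk lt by auto
    show ?thesis unfolding 1 using 2 3 inj
      by (auto simp: transpose_def split: if_splits)
  qed
  then show "inversions (transpose k (k + 1) \<circ> p) = insert (r k, r (k + 1)) (inversions p)"
    by (auto simp: inversions_def)
qed

lemma inversions_ascending_Cons:
  assumes "perm_of_word (rev ks) k < perm_of_word (rev ks) (k + 1)"
  shows "inversions (perm_of_word (k # ks)) =
      insert (perm_of_word (rev ks) k, perm_of_word (rev ks) (k + 1)) (inversions (perm_of_word ks))"
    and "(perm_of_word (rev ks) k, perm_of_word (rev ks) (k + 1)) \<notin> inversions (perm_of_word ks)"
  using inversions_transpose_comp[of "perm_of_word (rev ks)" "perm_of_word ks" k] assms
  by (simp_all add: perm_of_word_Cons)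

lemma inversions_descending_Cons:
  assumes "\<not> perm_of_word (rev ks) k < perm_of_word (rev ks) (k + 1)"
  shows "\<exists>d. inversions (perm_of_word ks) = insert d (inversions (perm_of_word (k # ks)))"
proof -
  have "perm_of_word (rev ks) k \<noteq> perm_of_word (rev ks) (k + 1)"
    by (metis perm_of_word_rev_right n_not_Suc_n Suc_eq_plus1)
  then have "perm_of_word (rev (k # ks)) k < perm_of_word (rev (k # ks)) (k + 1)"
    using assms by (simp add: perm_of_word_append perm_of_word_Cons)
  from inversions_ascending_Cons(1)[OF this]
  show ?thesis by (simp add: perm_of_word_Cons flip: comp_assoc) blast
qed

lemma finite_inversions: "finite (inversions (perm_of_word ks))"
proof (induction ks)
  case (Cons k ks)
  then show ?case
    using inversions_ascending_Cons(1)[of ks k] inversions_descending_Cons[of ks k]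
    by (cases "perm_of_word (rev ks) k < perm_of_word (rev ks) (k + 1)") auto
qed simp

lemma card_inversions_le: "card (inversions (perm_of_word ks)) \<le> length ks"
proof (induction ks)
  case (Cons k ks)
  show ?case
  proof (cases "perm_of_word (rev ks) k < perm_of_word (rev ks) (k + 1)")
    case True
    then show ?thesis using Cons inversions_ascending_Cons[OF True] finite_inversions[of ks] by simp
  next
    case False
    then have "inversions (perm_of_word (k # ks)) \<subseteq> inversions (perm_of_word ks)"
      using inversions_descending_Cons[OF False] by auto
    then show ?thesis using Cons card_mono[OF finite_inversions] by (metis le_SucI le_trans length_Cons)
  qed
qed simp

lemma ascending_iff_card: "ascending ks \<longleftrightarrow> length ks = card (inversions (perm_of_word ks))"
proof (induction ks)
  case (Cons k ks)
  show ?case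
  proof (cases "perm_of_word (rev ks) k < perm_of_word (rev ks) (k + 1)")
    case True
    then show ?thesis using Cons inversions_ascending_Cons[OF True] finite_inversions[of ks] by simp
  next
    case False
    then have "inversions (perm_of_word (k # ks)) \<subseteq> inversions (perm_of_word ks)"
      using inversions_descending_Cons[OF False] by auto
    then have "card (inversions (perm_of_word (k # ks))) \<le> length ks"
      using card_mono[OF finite_inversions] card_inversions_le le_trans by blast
    then show ?thesis using False by simp
  qed
qed simp

text \<open>The inverse of the coset representative \<open>rev [k..<n]\<close>: the cycle carrying \<open>n\<close> down to \<open>k\<close>. It is
increasing on the values below \<open>n\<close>, which is what makes the representative minimal in its coset.\<close>

lemma perm_of_word_upt:
  "k \<le> n \<Longrightarrow> perm_of_word [k..<n] c = (if c < k then c else if c < n then c + 1 else if c = n then k else c)"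
proof (induction "n - k" arbitrary: k)
  case (Suc d)
  then have "[k..<n] = k # [k + 1..<n]" by (simp add: upt_conv_Cons)
  then show ?case using Suc by (auto simp: perm_of_word_Cons transpose_def)
qed auto

lemma ascending_rev_upt: "k \<le> n \<Longrightarrow> ascending (rev [k..<n])"
proof (induction n)
  case (Suc n)
  show ?case
  proof (cases "k = Suc n")
    case False
    then show ?thesis using Suc by (simp add: perm_of_word_upt)
  qed simp
qed simp

text \<open>Lengths add up in \<open>u \<circ> d\<close>, for \<open>u\<close> in the smaller symmetric group and \<open>d\<close> a coset representative:
\<open>d\<inverse>\<close> preserves the order of all values that the letters of \<open>u\<close> compare.\<close>

lemma ascending_append_rev_upt:
  assumes "ascending ks" "set ks \<subseteq> {1..<n}" "1 \<le> k" "k \<le> Suc n"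
  shows "ascending (ks @ rev [k..<Suc n])"
  using assms(1,2)
proof (induction ks)
  case Nil
  show ?case using ascending_rev_upt[OF assms(4)] by simp
next
  case (Cons j ks)
  let ?r = "perm_of_word (rev ks)"
  have p: "?r permutes {1..n}" using Cons by (intro perm_of_word_permutes) auto
  have "?r j \<in> {1..n}" "?r (j + 1) \<in> {1..n}"
    using permutes_in_image[OF p, of j] permutes_in_image[OF p, of "j + 1"] Cons.prems by auto
  moreover have "?r j < ?r (j + 1)" using Cons by simp
  ultimately have "perm_of_word [k..<Suc n] (?r j) < perm_of_word [k..<Suc n] (?r (j + 1))"
    using assms by (simp add: perm_of_word_upt del: upt_Suc)
  then show ?case using Cons by (simp add: perm_of_word_append del: upt_Suc)
qed

text \<open>The representative is found from the position \<open>k\<close> of the value \<open>n + 1\<close>: after moving this value to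
the end, the remaining factor fixes \<open>n + 1\<close>.\<close>

lemma permutes_Suc_decompose:
  assumes "p permutes {1..Suc n}"
  obtains u k where "u permutes {1..n}" "k \<in> {1..Suc n}" "p = u \<circ> perm_of_word (rev [k..<Suc n])"
proof -
  define k where "k = inv_into UNIV p (Suc n)"
  have k: "k \<in> {1..Suc n}" unfolding k_def
    using permutes_in_image[OF permutes_inv[OF assms], of "Suc n"] by simp
  define u where "u = p \<circ> perm_of_word [k..<Suc n]"
  have "perm_of_word [k..<Suc n] permutes {1..Suc n}"
    using k by (intro perm_of_word_permutes) auto
  then have u: "u permutes {1..Suc n}" unfolding u_def using assms permutes_compose by blast
  have "u (Suc n) = Suc n"
    using k permutes_inverses(1)[OF assms, of "Suc n"]
    by (simp add: u_def perm_of_word_upt k_def del: upt_Suc)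
  then have "u permutes {1..n}"
    using u by (intro permutes_superset[OF u]) (auto simp: le_Suc_eq)
  moreover have "p = u \<circ> perm_of_word (rev [k..<Suc n])"
    by (simp add: u_def comp_def fun_eq_iff del: upt_Suc)
  ultimately show ?thesis using k that by blast
qed

lemma exists_ascending_expression:
  "p permutes {1..n} \<Longrightarrow> \<exists>ks. is_expression n ks p \<and> ascending ks"
proof (induction n arbitrary: p)
  case 0
  then show ?case by (auto simp: is_expression_def intro!: exI[of _ "[]"])
next
  case (Suc n)
  obtain u k where u: "u permutes {1..n}" "k \<in> {1..Suc n}"
    "p = u \<circ> perm_of_word (rev [k..<Suc n])"
    using permutes_Suc_decompose[OF Suc.prems] .
  obtain ks where ks: "is_expression n ks u" "ascending ks" using Suc.IH[OF u(1)] by blast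
  have "is_expression (Suc n) (ks @ rev [k..<Suc n]) p"
    using ks u by (auto simp: is_expression_def perm_of_word_append)
  moreover have "ascending (ks @ rev [k..<Suc n])"
    using ks u by (intro ascending_append_rev_upt) (auto simp: is_expression_def)
  ultimately show ?case by blast
qed

text \<open>An ascending expression has as many letters as the permutation has inversions, and no expression can
have fewer, as one letter creates at most one inversion.\<close>

lemma is_reduced_expression_iff:
  assumes "p permutes {1..n}"
  shows "is_reduced_expression n ks p \<longleftrightarrow> is_expression n ks p \<and> ascending ks"
proof -
  obtain js where js: "is_expression n js p" "ascending js"
    using exists_ascending_expression[OF assms] by blast
  then have len: "length js = card (inversions p)"
    by (auto simp: ascending_iff_card is_expression_def)
  have le: "card (inversions p) \<le> length hs" if "is_expression n hs p" for hs
    using that card_inversions_le[of hs] by (auto simp: is_expression_def)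
  have asc: "ascending hs \<longleftrightarrow> length hs = card (inversions p)" if "is_expression n hs p" for hs
    using that by (auto simp: is_expression_def ascending_iff_card)
  show ?thesis
  proof
    assume "is_reduced_expression n ks p"
    then have ks: "is_expression n ks p" "length ks \<le> length js"
      using js(1) by (auto simp: is_reduced_expression_def)
    then show "is_expression n ks p \<and> ascending ks" using len le[OF ks(1)] asc[OF ks(1)] by simp
  next
    assume "is_expression n ks p \<and> ascending ks"
    then show "is_reduced_expression n ks p"
      using le asc[of ks] by (simp add: is_reduced_expression_def)
  qed
qed

lemma reduced_expression_some:
  assumes "p permutes {1..n}"
  shows "is_reduced_expression n (SOME ks. is_reduced_expression n ks p) p"
proof (rule someI_ex)
  show "\<exists>ks. is_reduced_expression n ks p"
    unfolding is_reduced_expression_iff[OF assms] using assms by (rule exists_ascending_expression)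
qed

section \<open>The braid action on words\<close>

lemma tlinear_braid_gen: "tlinear (braid_gen q k)"
  unfolding braid_gen_def by (rule tlinear_linear_ext)

lemma braid_act_Nil [simp]: "braid_act q [] x = x"
  and braid_act_Cons: "braid_act q (k # ks) x = braid_gen q k (braid_act q ks x)"
  and braid_act_append: "braid_act q (ks @ js) x = braid_act q ks (braid_act q js x)"
  by (simp_all add: braid_act_def)

lemma tlinear_braid_act: "tlinear (braid_act q ks)"
proof (induction ks)
  case Nil
  show ?case using tlinear_id by (simp add: braid_act_def id_def)
next
  case (Cons i u)
  then show ?case using tlinear_comp[OF tlinear_braid_gen Cons] by (simp add: braid_act_def comp_def)
qed

lemma braid_gen_basis:
  fixes q :: "'i \<Rightarrow> 'i \<Rightarrow> 'k::field"
  assumes "length u = k - 1" "1 \<le> k"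
  shows "braid_gen q k (basis_tensor (u @ i # j # v))
       = tscale (q i j) (basis_tensor (u @ j # i # v))"
proof -
  have d: "drop (k + 1) (u @ i # j # v) = v" "drop (k - 1) (u @ i # j # v) = i # j # v"
    "take (k - 1) (u @ i # j # v) = u"
    using assms by auto
  have "(basis_tensor (u @ j # i # v) :: ('i, 'k) tensor) = basis_tensor u * basis_tensor [j, i] * basis_tensor v"
    by (simp flip: basis_append)
  then show ?thesis
    unfolding braid_gen_def linear_ext_basis d
    by (simp add: braiding_def numeral_2_eq_2 tscale_mult_left tscale_mult_right)
qed

lemma braid_gen_basis_nth:
  assumes "1 \<le> k" "k < length w"
  shows "braid_gen q k (basis_tensor w)
       = tscale (q (w ! (k - 1)) (w ! k)) (basis_tensor (w[k - 1 := w ! k, k := w ! (k - 1)]))"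
proof -
  define u v where "u = take (k - 1) w" and "v = drop (k + 1) w"
  have w: "w = u @ w ! (k - 1) # w ! k # v"
    using assms id_take_nth_drop[of "k - 1" w] Cons_nth_drop_Suc[of k w] by (simp add: u_def v_def)
  have lu: "length u = k - 1" using assms by (simp add: u_def)
  have "w[k - 1 := w ! k, k := w ! (k - 1)] = u @ w ! k # w ! (k - 1) # v"
  proof -
    have "(u @ a # b # v)[length u := b, Suc (length u) := a] = u @ b # a # v" for a b
      by (simp add: list_update_append)
    then show ?thesis using w lu assms(1) by (metis Suc_diff_1 One_nat_def Suc_le_eq)
  qed
  then show ?thesis using braid_gen_basis[OF lu assms(1), of q "w ! (k - 1)" "w ! k" v] w by metis
qed

text \<open>The key to the independence of \<open>T\<^sub>w\<close> from the reduced expression. For a diagonal braiding there is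
an explicit formula: the letters of \<open>w\<close> are permuted, and each pair of letters that changes its order
contributes its scalar exactly once, because an ascending expression never exchanges the same pair
of letters twice. Only the permutation enters this formula.\<close>

lemma braid_act_ascending:
  fixes q :: "'i \<Rightarrow> 'i \<Rightarrow> 'k::field"
  assumes "ascending ks" "set ks \<subseteq> {1..<n}" "length w = n"
  shows "braid_act q ks (basis_tensor w) =
    tscale (\<Prod>(a, b)\<in>inversions (perm_of_word ks). q (w ! (a - 1)) (w ! (b - 1)))
      (basis_tensor (map (\<lambda>c. w ! (perm_of_word (rev ks) c - 1)) [1..<Suc n]))"
  using assms(1,2)
proof (induction ks)
  case Nil
  have "map (\<lambda>c. w ! (c - 1)) [1..<Suc n] = w"
    using assms(3) by (intro nth_equalityI) (auto simp del: upt_Suc)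
  then show ?case by (simp add: case_prod_unfold del: upt_Suc)
next
  case (Cons k ks)
  let ?r = "perm_of_word (rev ks)"
  define v where "v = map (\<lambda>c. w ! (?r c - 1)) [1..<Suc n]"
  let ?f = "\<lambda>c. w ! (perm_of_word (rev (k # ks)) c - 1)"
  have lt: "?r k < ?r (k + 1)" and k: "1 \<le> k" "k < n" using Cons.prems by auto
  have nth: "map f [1..<Suc n] ! i = f (Suc i)" if "i < n" for i and f :: "nat \<Rightarrow> 'i"
    using that by (simp del: upt_Suc)
  have v: "v ! i = w ! (?r (Suc i) - 1)" if "i < n" for i
    using nth[OF that] by (simp only: v_def)
  have len: "length v = n" by (simp add: v_def del: upt_Suc)
  have vk: "v ! (k - 1) = w ! (?r k - 1)" "v ! k = w ! (?r (k + 1) - 1)"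
    using v[of "k - 1"] v[of k] k by simp_all
  \<comment> \<open>The letter \<open>k\<close> of the expression exchanges the letters of the word that have arrived at the
    places \<open>k\<close> and \<open>k + 1\<close>; the list indices are one less.\<close>
  have swap: "v[k - 1 := v ! k, k := v ! (k - 1)] = map ?f [1..<Suc n]"
  proof (rule nth_equalityI)
    fix i assume "i < length (v[k - 1 := v ! k, k := v ! (k - 1)])"
    then have i: "i < n" by (simp add: len)
    have "v[k - 1 := v ! k, k := v ! (k - 1)] ! i = ?f (Suc i)"
      using i k by (auto simp: len v nth_list_update perm_of_word_append perm_of_word_Cons transpose_def)
    then show "v[k - 1 := v ! k, k := v ! (k - 1)] ! i = map ?f [1..<Suc n] ! i"
      using nth[OF i, of ?f] by (rule trans[OF _ sym])
  qed (simp add: len del: upt_Suc)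
  have "braid_act q (k # ks) (basis_tensor w) =
    tscale (\<Prod>(a, b)\<in>inversions (perm_of_word ks). q (w ! (a - 1)) (w ! (b - 1)))
      (braid_gen q k (basis_tensor v))"
    using Cons by (simp add: braid_act_Cons tlinear_scale[OF tlinear_braid_gen] v_def del: upt_Suc)
  also have "braid_gen q k (basis_tensor v) =
     tscale (q (w ! (?r k - 1)) (w ! (?r (k + 1) - 1))) (basis_tensor (map ?f [1..<Suc n]))"
    using braid_gen_basis_nth[of k v q] k unfolding len swap unfolding vk by simp
  finally show ?case
    using inversions_ascending_Cons[OF lt] finite_inversions[of ks]
    by (simp add: mult.commute del: upt_Suc rev.simps)
qed

lemma perm_op_eq_braid_act:
  assumes "p permutes {1..n}" "is_expression n ks p" "ascending ks" "x \<in> tensor_power n"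
  shows "perm_op q n p x = braid_act q ks x"
proof -
  define js where "js = (SOME ks. is_reduced_expression n ks p)"
  have js: "is_expression n js p" "ascending js"
    unfolding js_def using reduced_expression_some[OF assms(1)] is_reduced_expression_iff[OF assms(1)]
    by auto
  then have p: "perm_of_word js = perm_of_word ks" "set js \<subseteq> {1..<n}" "set ks \<subseteq> {1..<n}"
    using assms(2) by (simp_all add: is_expression_def)
  have "braid_act q js x = braid_act q ks x"
    by (rule tlinear_eq_on_tensor_power[OF tlinear_braid_act tlinear_braid_act _ assms(4)])
      (simp only: braid_act_ascending[OF js(2) p(2)] braid_act_ascending[OF assms(3) p(3)]
        perm_of_word_rev_eq p(1))
  then show ?thesis by (simp add: perm_op_def js_def)
qed

lemma braid_gen_mult_letter:
  assumes "x \<in> tensor_power n" "1 \<le> k" "k < n"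
  shows "braid_gen q k (x * letter j) = braid_gen q k x * letter j"
proof (rule tlinear_eq_on_tensor_power[OF _ _ _ assms(1)])
  show "tlinear (\<lambda>x. braid_gen q k (x * letter j))" "tlinear (\<lambda>x. braid_gen q k x * letter j)"
    by (intro tlinear_intros tlinear_comp[OF tlinear_braid_gen] tlinear_braid_gen)+
  fix w :: "'a list" assume "length w = n"
  then have w: "w = take (k - 1) w @ w ! (k - 1) # w ! k # drop (k + 1) w"
    using assms id_take_nth_drop[of "k - 1" w] Cons_nth_drop_Suc[of k w] by simp
  then obtain u a b v where "w = u @ a # b # v" "length u = k - 1"
    using assms \<open>length w = n\<close>
    by (metis (no_types, lifting) length_take min.absorb2 less_imp_diff_less less_imp_le_nat)
  then show "braid_gen q k (basis_tensor w * letter j) = braid_gen q k (basis_tensor w) * letter j"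
    using braid_gen_basis[of u k q a b v] braid_gen_basis[of u k q a b "v @ [j]"] assms(2)
    by (simp add: tscale_mult_left flip: basis_snoc)
qed

lemma braid_gen_in_tensor_power:
  assumes "x \<in> tensor_power n" "1 \<le> k" "k < n"
  shows "braid_gen q k x \<in> tensor_power n"
  by (rule tlinear_tensor_power[OF tlinear_braid_gen _ assms(1)])
    (use assms(2,3) in \<open>simp add: braid_gen_basis_nth tensor_power_scale basis_in_tensor_power\<close>)

text \<open>Braidings of the first \<open>n\<close> places act on \<open>V\<^bsup>\<otimes>n\<^esup> \<otimes> V\<close> through the left factor.\<close>

lemma braid_act_mult_letter:
  assumes "x \<in> tensor_power n" "set ks \<subseteq> {1..<n}"
  shows "braid_act q ks x \<in> tensor_power n"
    and "braid_act q ks (x * letter j) = braid_act q ks x * letter j"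
proof -
  have "braid_act q ks x \<in> tensor_power n \<and> braid_act q ks (x * letter j) = braid_act q ks x * letter j"
    using assms
    by (induction ks) (auto simp: braid_act_Cons braid_gen_in_tensor_power braid_gen_mult_letter)
  then show "braid_act q ks x \<in> tensor_power n"
    "braid_act q ks (x * letter j) = braid_act q ks x * letter j" by auto
qed

lemma braid_gen_mult_two_letters:
  assumes "x \<in> tensor_power (n - 1)" "1 \<le> n"
  shows "braid_gen q n (x * letter i * letter j) = tscale (q i j) (x * letter j * letter i)"
proof (rule tlinear_eq_on_tensor_power[OF _ _ _ assms(1)])
  show "tlinear (\<lambda>x. braid_gen q n (x * letter i * letter j))"
    "tlinear (\<lambda>x. tscale (q i j) (x * letter j * letter i))"
    by (intro tlinear_intros tlinear_comp[OF tlinear_braid_gen])+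
  fix w :: "'a list" assume "length w = n - 1"
  then show "braid_gen q n (basis_tensor w * letter i * letter j) =
      tscale (q i j) (basis_tensor w * letter j * letter i)"
    using braid_gen_basis[of w n q i j "[]"] assms(2) by (simp flip: basis_snoc)
qed

lemma tlinear_right_diff: "tlinear (right_diff q n)"
  unfolding right_diff_def by (intro tlinear_setsum tlinear_braid_act)

text \<open>This is \<open>T\<^bsub>n+1\<^esub> = 1 + \<sigma>\<^sub>n (T\<^sub>n \<otimes> id)\<close>: in every summand but the identity the last operator applied
is \<open>\<sigma>\<^sub>n\<close>, and it is preceded by a summand of \<open>T\<^sub>n\<close>.\<close>

lemma right_diff_mult_letter:
  assumes "x \<in> tensor_power n"
  shows "right_diff q (Suc n) (x * letter j) = x * letter j + braid_gen q n (right_diff q n x * letter j)"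
proof -
  have "braid_act q (rev [k..<Suc n]) (x * letter j)
      = braid_gen q n (braid_act q (rev [k..<n]) x * letter j)" if "k \<in> {1..n}" for k
    using that braid_act_mult_letter(2)[OF assms, of "rev [k..<n]" q j]
    by (simp add: braid_act_Cons)
  then have "(\<Sum>k = 1..n. braid_act q (rev [k..<Suc n]) (x * letter j))
      = braid_gen q n (right_diff q n x * letter j)"
    by (simp add: right_diff_def sum_distrib_right tlinear_sum[OF tlinear_braid_gen])
  then show ?thesis by (simp add: right_diff_def add.commute)
qed

text \<open>The recursion for \<open>T\<^bsub>n+1\<^esub>\<close> is the recursion of the skew derivations: if \<open>T\<^sub>n w = \<Sum>\<^sub>i \<partial>\<^sub>i(w) v\<^sub>i\<close>, then
\<open>\<sigma>\<^sub>n (T\<^sub>n(w) v\<^sub>j) = \<Sum>\<^sub>i q\<^sub>i\<^sub>j \<partial>\<^sub>i(w) v\<^sub>j v\<^sub>i\<close>.\<close>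

lemma right_diff_eq_sum_partial:
  fixes q :: "'i::finite \<Rightarrow> 'i \<Rightarrow> 'k::field"
  assumes "x \<in> tensor_power n"
  shows "right_diff q n x = (\<Sum>i\<in>UNIV. partial q i x * letter i)"
proof (rule tlinear_eq_on_tensor_power[OF tlinear_right_diff _ _ assms])
  show "tlinear (\<lambda>x. \<Sum>i\<in>UNIV. partial q i x * letter i)"
    by (intro tlinear_setsum tlinear_skew_intros)
  fix w :: "'i list" assume "length w = n"
  then show "right_diff q n (basis_tensor w) = (\<Sum>i\<in>UNIV. partial q i (basis_tensor w) * letter i)"
  proof (induction w arbitrary: n rule: rev_induct)
    case Nil
    then show ?case by (simp add: right_diff_def)
  next
    case (snoc j w)
    let ?n = "length w"
    have "braid_gen q ?n (partial q i (basis_tensor w) * letter i * letter j)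
        = tscale (q i j) (partial q i (basis_tensor w) * letter j * letter i)" for i
    proof (cases "?n = 0")
      case False
      then show ?thesis
        by (intro braid_gen_mult_two_letters partial_in_tensor_power basis_in_tensor_power)
          (auto simp: Suc_le_eq)
    qed (simp add: tlinear_zero[OF tlinear_braid_gen])
    then have "braid_gen q ?n (right_diff q ?n (basis_tensor w) * letter j)
        = (\<Sum>i\<in>UNIV. tscale (q i j) (partial q i (basis_tensor w) * letter j * letter i))"
      by (simp add: snoc.IH[OF refl] sum_distrib_right tlinear_sum[OF tlinear_braid_gen])
    moreover have "(\<Sum>i\<in>UNIV. (if i = j then basis_tensor w else 0) * letter i)
        = (basis_tensor w * letter j :: ('i, 'k) tensor)"
      by (simp add: if_distrib[of "\<lambda>x. x * _"] cong: if_cong)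
    ultimately show ?case
      using snoc.prems right_diff_mult_letter[of "basis_tensor w" ?n q j]
      by (auto simp add: basis_snoc basis_in_tensor_power partial_mult_letter distrib_right
          sum.distrib tscale_mult_left)
  qed
qed

lemma bij_betw_permutes_Suc:
  "bij_betw (\<lambda>(u, k). u \<circ> perm_of_word (rev [k..<Suc n]))
     ({u. u permutes {1..n}} \<times> {1..Suc n}) {p. p permutes {1..Suc n}}"
proof (rule bij_betw_imageI)
  let ?d = "\<lambda>k. perm_of_word (rev [k..<Suc n])"
  have d: "?d k k = Suc n" if "k \<le> Suc n" for k
    using perm_of_word_rev_left[of "[k..<Suc n]" "Suc n"] that by (simp add: perm_of_word_upt del: upt_Suc)
  have surj: "\<exists>b. ?d k b = c" for k c using perm_of_word_rev_left by blast
  have inj: "?d k a = ?d k b \<longleftrightarrow> a = b" for k a b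
    using perm_of_word_rev_right[of "[k..<Suc n]"] by metis
  have fix_Suc: "u (Suc n) = Suc n" if "u permutes {1..n}" for u
    using permutes_not_in[OF that] by simp
  show "inj_on (\<lambda>(u, k). u \<circ> ?d k) ({u. u permutes {1..n}} \<times> {1..Suc n})"
  proof (rule inj_onI, clarify)
    fix u k u' k'
    assume u: "u permutes {1..n}" "u' permutes {1..n}" and k: "k \<in> {1..Suc n}" "k' \<in> {1..Suc n}"
      and eq: "u \<circ> ?d k = u' \<circ> ?d k'"
    have "u' (?d k' k) = u' (?d k' k')"
      using fun_cong[OF eq, of k] d k fix_Suc[OF u(1)] fix_Suc[OF u(2)] by (simp del: upt_Suc)
    then have "k = k'" using permutes_inj[OF u(2)] inj by (simp add: inj_eq)
    moreover have "u c = u' c" for c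
      using fun_cong[OF eq] surj[of k c] calculation by (metis comp_apply)
    ultimately show "u = u' \<and> k = k'" by blast
  qed
  show "(\<lambda>(u, k). u \<circ> ?d k) ` ({u. u permutes {1..n}} \<times> {1..Suc n}) = {p. p permutes {1..Suc n}}"
  proof (intro subset_antisym subsetI)
    fix p assume "p \<in> (\<lambda>(u, k). u \<circ> ?d k) ` ({u. u permutes {1..n}} \<times> {1..Suc n})"
    then obtain u k where "u permutes {1..n}" "k \<in> {1..Suc n}" and p: "p = u \<circ> ?d k" by auto
    then have "u permutes {1..Suc n}" by (simp add: permutes_subset[of u "{1..n}"])
    moreover have "?d k permutes {1..Suc n}"
      using \<open>k \<in> {1..Suc n}\<close> by (intro perm_of_word_permutes) auto
    ultimately show "p \<in> {p. p permutes {1..Suc n}}" unfolding p using permutes_compose by blast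
  next
    fix p assume "p \<in> {p. p permutes {1..Suc n}}"
    then obtain u k where "u permutes {1..n}" "k \<in> {1..Suc n}" "p = u \<circ> ?d k"
      using permutes_Suc_decompose by blast
    then show "p \<in> (\<lambda>(u, k). u \<circ> ?d k) ` ({u. u permutes {1..n}} \<times> {1..Suc n})"
      by (intro image_eqI[of _ _ "(u, k)"]) (simp_all del: upt_Suc)
  qed
qed

text \<open>The factorization \<open>S\<^bsub>n+1\<^esub> = (S\<^sub>n \<otimes> id) T\<^bsub>n+1\<^esub>\<close>. Reduced expressions of \<open>u \<in> \<SS>\<^sub>n\<close> and of a minimal
coset representative concatenate to a reduced expression of the product, so \<open>T\<^bsub>u d\<^esub> = T\<^sub>u T\<^sub>d\<close>, and the
sum over \<open>d\<close> is \<open>T\<^bsub>n+1\<^esub>\<close>.\<close>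

lemma total_symm_Suc:
  fixes q :: "'i::finite \<Rightarrow> 'i \<Rightarrow> 'k::field"
  assumes x: "x \<in> tensor_power (Suc n)"
  shows "total_symm q (Suc n) x = (\<Sum>i\<in>UNIV. total_symm q n (partial q i x) * letter i)"
proof -
  let ?d = "\<lambda>k. rev [k..<Suc n]"
  let ?U = "{u. u permutes {1..n}}"
  define e where "e u = (SOME ks. is_reduced_expression n ks u)" for u
  have e: "is_expression n (e u) u" "ascending (e u)" if "u permutes {1..n}" for u
    using reduced_expression_some[OF that] is_reduced_expression_iff[OF that] by (auto simp: e_def)
  have op: "perm_op q (Suc n) (u \<circ> perm_of_word (?d k)) x = braid_act q (e u) (braid_act q (?d k) x)"
    if "u permutes {1..n}" "k \<in> {1..Suc n}" for u k
  proof -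
    have ex: "is_expression (Suc n) (e u @ ?d k) (u \<circ> perm_of_word (?d k))"
      using e(1)[OF that(1)] that(2)
      by (auto simp: is_expression_def perm_of_word_append simp del: upt_Suc)
    have "u \<circ> perm_of_word (?d k) permutes {1..Suc n}"
      using ex perm_of_word_permutes by (metis is_expression_def)
    moreover have "ascending (e u @ ?d k)"
      using e[OF that(1)] that(2) by (intro ascending_append_rev_upt) (auto simp: is_expression_def)
    ultimately show ?thesis using perm_op_eq_braid_act[OF _ ex _ x] braid_act_append by metis
  qed
  have "total_symm q (Suc n) x
      = (\<Sum>(u, k)\<in>?U \<times> {1..Suc n}. perm_op q (Suc n) (u \<circ> perm_of_word (?d k)) x)"
    unfolding total_symm_def sum.reindex_bij_betw[OF bij_betw_permutes_Suc, symmetric]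
    by (simp add: case_prod_unfold del: upt_Suc)
  also have "\<dots> = (\<Sum>u\<in>?U. \<Sum>k\<in>{1..Suc n}. braid_act q (e u) (braid_act q (?d k) x))"
    unfolding sum.cartesian_product by (intro sum.cong) (auto simp: op simp del: upt_Suc)
  also have "\<dots> = (\<Sum>u\<in>?U. braid_act q (e u) (right_diff q (Suc n) x))"
    unfolding right_diff_def by (simp only: tlinear_sum[OF tlinear_braid_act])
  also have "\<dots> = (\<Sum>u\<in>?U. \<Sum>i\<in>UNIV. perm_op q n u (partial q i x) * letter i)"
  proof (rule sum.cong[OF refl])
    fix u assume "u \<in> ?U"
    then have "set (e u) \<subseteq> {1..<n}" using e(1) by (auto simp: is_expression_def)
    then show "braid_act q (e u) (right_diff q (Suc n) x)
        = (\<Sum>i\<in>UNIV. perm_op q n u (partial q i x) * letter i)"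
      using partial_in_tensor_power[OF x]
      by (simp add: right_diff_eq_sum_partial[OF x] tlinear_sum[OF tlinear_braid_act]
          braid_act_mult_letter(2)[of _ n] perm_op_def e_def)
  qed
  also have "\<dots> = (\<Sum>i\<in>UNIV. total_symm q n (partial q i x) * letter i)"
    by (subst sum.swap) (simp add: total_symm_def sum_distrib_right)
  finally show ?thesis .
qed

lemma total_symm_0:
  assumes "x \<in> tensor_power 0"
  shows "total_symm q 0 x = x"
proof -
  have "perm_op q 0 id x = braid_act q [] x"
    by (rule perm_op_eq_braid_act)
      (use assms in \<open>auto simp: is_expression_def permutes_id\<close>)
  then show ?thesis by (simp add: total_symm_def)
qed

text \<open>Iterating the factorization peels off one derivation per degree, down to \<open>S\<^sub>0 = id\<close>.\<close>

lemma total_symm_eq_0_iff: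
  fixes q :: "'i::finite \<Rightarrow> 'i \<Rightarrow> 'k::field"
  assumes "x \<in> tensor_power n"
  shows "total_symm q n x = 0 \<longleftrightarrow> (\<forall>u. length u = n \<longrightarrow> partials q u x = 0)"
  using assms
proof (induction n arbitrary: x)
  case 0
  then show ?case by (simp add: total_symm_0)
next
  case (Suc n)
  have IH: "total_symm q n (partial q i x) = 0
      \<longleftrightarrow> (\<forall>u. length u = n \<longrightarrow> partials q u (partial q i x) = 0)" for i
    using Suc.IH partial_in_tensor_power[OF Suc.prems] by simp
  have "total_symm q (Suc n) x = 0
      \<longleftrightarrow> (\<forall>i u. length u = n \<longrightarrow> partials q u (partial q i x) = 0)"
    by (simp only: total_symm_Suc[OF Suc.prems] sum_mult_letter_eq_0_iff IH)
  also have "\<dots> \<longleftrightarrow> (\<forall>u. length u = Suc n \<longrightarrow> partials q u x = 0)"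
  proof (intro iffI allI impI)
    fix v :: "'i list"
    assume "\<forall>i u. length u = n \<longrightarrow> partials q u (partial q i x) = 0" "length v = Suc n"
    then show "partials q v x = 0"
      by (cases v rule: rev_cases) (auto simp: partials_append partials_Cons)
  next
    fix i and u :: "'i list"
    assume "\<forall>u. length u = Suc n \<longrightarrow> partials q u x = 0" "length u = n"
    then have "partials q (u @ [i]) x = 0" by simp
    then show "partials q u (partial q i x) = 0" by (simp add: partials_append partials_Cons)
  qed
  finally show ?case .
qed

lemma right_constants_iff:
  fixes q :: "'i::finite \<Rightarrow> 'i \<Rightarrow> 'k::field"
  shows "x \<in> right_constants q n \<longleftrightarrow> x \<in> tensor_power n \<and> (\<forall>i. partial q i x = 0)"
  by (auto simp: right_constants_def right_diff_eq_sum_partial sum_mult_letter_eq_0_iff)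

section \<open>The radical of the skew derivations\<close>

text \<open>Subspaces killed by the projection onto degree \<open>0\<close> and stable under all \<open>\<partial>\<^sub>i\<close> have a largest
member, and this is it. In degree \<open>n\<close> it consists of the tensors killed by all products of \<open>n\<close>
derivations, but in this form it needs no reference to degrees and is visibly a subspace.\<close>

definition derivation_radical :: "('i \<Rightarrow> 'i \<Rightarrow> 'k::field) \<Rightarrow> ('i, 'k) tensor set" where
  "derivation_radical q = {x. \<forall>u. Poly_Mapping.lookup (partials q u x) [] = 0}"

lemma derivation_radical_partial:
  "x \<in> derivation_radical q \<Longrightarrow> partial q i x \<in> derivation_radical q"
  unfolding derivation_radical_def using partials_append[of q _ "[i]"]
  by (simp add: partials_Cons) metis

lemma derivation_radical_twist:
  "x \<in> derivation_radical q \<Longrightarrow> twist f x \<in> derivation_radical q"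
  by (simp add: derivation_radical_def partials_twist lookup_tscale lookup_twist_Nil)

lemma derivation_radical_lookup_Nil: "x \<in> derivation_radical q \<Longrightarrow> Poly_Mapping.lookup x [] = 0"
  unfolding derivation_radical_def by (metis (mono_tags, lifting) mem_Collect_eq partials_Nil)

text \<open>The Leibniz rule moves each derivation onto one of the factors, and the factor from the radical stays
in it, as the radical is stable under derivations and twists. In the end the constant term is taken,
which is multiplicative.\<close>

lemma lookup_partials_mult_eq_0:
  assumes "x \<in> derivation_radical q"
  shows "Poly_Mapping.lookup (partials q u (x * y)) [] = 0"
    and "Poly_Mapping.lookup (partials q u (y * x)) [] = 0"
proof -
  show "Poly_Mapping.lookup (partials q u (x * y)) [] = 0"
    using assms
  proof (induction u arbitrary: x y rule: rev_induct)
    case (snoc i u)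
    then show ?case
      by (simp add: partials_append partials_Cons partial_mult tlinear_add[OF tlinear_partials]
          lookup_add derivation_radical_partial)
  qed (simp add: lookup_mult_Nil derivation_radical_lookup_Nil)
  show "Poly_Mapping.lookup (partials q u (y * x)) [] = 0"
    using assms
  proof (induction u arbitrary: x y rule: rev_induct)
    case (snoc i u)
    then show ?case
      by (simp add: partials_append partials_Cons partial_mult tlinear_add[OF tlinear_partials]
          lookup_add derivation_radical_partial derivation_radical_twist)
  qed (simp add: lookup_mult_Nil derivation_radical_lookup_Nil)
qed

lemma ring_tensor: "ring (ring_of_type_algebra :: ('i, 'k::field) tensor ring)"
proof -
  have "\<exists>y. x + y = 0" for x :: "('i, 'k) tensor" using add.right_inverse by blast
  then show ?thesis
    unfolding ring_of_type_algebra_def using add.right_inverse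
    by unfold_locales (auto simp: algebra_simps Units_def)
qed

lemma ideal_tensorI:
  fixes I :: "('i, 'k::field) tensor set"
  assumes "0 \<in> I" "\<And>x y. x \<in> I \<Longrightarrow> y \<in> I \<Longrightarrow> x + y \<in> I"
    and "\<And>x y. x \<in> I \<Longrightarrow> y * x \<in> I" "\<And>x y. x \<in> I \<Longrightarrow> x * y \<in> I"
  shows "ideal I ring_of_type_algebra"
proof (rule idealI[OF ring_tensor])
  interpret R: ring "ring_of_type_algebra :: ('i, 'k) tensor ring" by (rule ring_tensor)
  show "subgroup I (add_monoid ring_of_type_algebra)"
  proof (rule R.add.subgroupI)
    fix x assume "x \<in> I"
    have "\<ominus>\<^bsub>ring_of_type_algebra\<^esub> x = - x"
      by (rule R.minus_equality) (simp_all add: ring_of_type_algebra_def)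
    moreover have "- x \<in> I" using assms(3)[OF \<open>x \<in> I\<close>, of "- 1"] by simp
    ultimately show "\<ominus>\<^bsub>ring_of_type_algebra\<^esub> x \<in> I" by simp
  qed (use assms in \<open>auto simp: ring_of_type_algebra_def\<close>)
qed (use assms in \<open>auto simp: ring_of_type_algebra_def\<close>)

lemma ideal_derivation_radical: "ideal (derivation_radical q) ring_of_type_algebra"
proof (rule ideal_tensorI)
  show "x * y \<in> derivation_radical q" "y * x \<in> derivation_radical q"
    if "x \<in> derivation_radical q" for x y
    using lookup_partials_mult_eq_0[OF that] by (auto simp: derivation_radical_def)
qed (auto simp: derivation_radical_def tlinear_zero[OF tlinear_partials]
    tlinear_add[OF tlinear_partials] lookup_add)

lemma subspace_derivation_radical: "tensor.subspace (derivation_radical q)"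
  by (auto simp: tensor.subspace_def derivation_radical_def tlinear_zero[OF tlinear_partials]
    tlinear_add[OF tlinear_partials] tlinear_scale[OF tlinear_partials] lookup_add lookup_tscale)

text \<open>The degree has to be positive: a scalar is killed by all derivations as well, but its own constant
term does not vanish.\<close>

lemma constant_in_derivation_radical:
  assumes "x \<in> tensor_power n" "n \<noteq> 0" "\<And>i. partial q i x = 0"
  shows "x \<in> derivation_radical q"
proof -
  have "Poly_Mapping.lookup (partials q u x) [] = 0" for u
    using assms by (cases u rule: rev_cases)
      (auto simp: partials_append partials_Cons tlinear_zero[OF tlinear_partials] tensor_power_iff)
  then show ?thesis by (simp add: derivation_radical_def)
qed

lemma genideal_tensor:
  fixes S :: "('i, 'k::field) tensor set"
  defines "I \<equiv> genideal ring_of_type_algebra S"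
  shows "S \<subseteq> I" "0 \<in> I" "x \<in> I \<Longrightarrow> y \<in> I \<Longrightarrow> x + y \<in> I" "x \<in> I \<Longrightarrow> x * y \<in> I"
proof -
  interpret R: ring "ring_of_type_algebra :: ('i, 'k) tensor ring" by (rule ring_tensor)
  have S: "S \<subseteq> carrier ring_of_type_algebra" by (simp add: ring_of_type_algebra_def)
  interpret I: ideal I ring_of_type_algebra unfolding I_def by (rule R.genideal_ideal[OF S])
  show "S \<subseteq> I" unfolding I_def by (rule R.genideal_self[OF S])
  show "0 \<in> I" using I.zero_closed by (simp add: ring_of_type_algebra_def)
  show "x \<in> I \<Longrightarrow> y \<in> I \<Longrightarrow> x + y \<in> I" using I.a_closed by (simp add: ring_of_type_algebra_def)
  show "x \<in> I \<Longrightarrow> x * y \<in> I" using I.I_r_closed[of x y] by (simp add: ring_of_type_algebra_def)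
qed

section \<open>Factoring iterated derivations\<close>

text \<open>For words \<open>u\<close> and \<open>w\<close> of equal length this is the scalar \<open>\<partial>\<^sub>u w\<close>, the entry of a square
matrix that governs the derivations of order \<open>length u\<close> on all of the tensor algebra.\<close>

abbreviation partials_coeff :: "('i \<Rightarrow> 'i \<Rightarrow> 'k::field) \<Rightarrow> 'i list \<Rightarrow> 'i list \<Rightarrow> 'k" where
  "partials_coeff q u w \<equiv> Poly_Mapping.lookup (partials q u (basis_tensor w)) []"
text \<open>The part of \<open>\<partial>\<^sub>u (x v\<^sub>j)\<close> in which one of the derivations has consumed the final \<open>v\<^sub>j\<close>, so that \<open>x\<close>
is hit by one derivation less.\<close>

primrec partials_cut :: "('i \<Rightarrow> 'i \<Rightarrow> 'k::field) \<Rightarrow> 'i \<Rightarrow> 'i list \<Rightarrow> ('i, 'k) tensor \<Rightarrow> ('i, 'k) tensor" where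
  "partials_cut q j [] x = 0"
| "partials_cut q j (i # u) x = partial q i (partials_cut q j u x)
     + (if i = j then tscale (prod_list (map (\<lambda>i. q i j) u)) (partials q u x) else 0)"

lemma partials_mult_letter:
  "partials q u (x * letter j)
     = partials_cut q j u x + tscale (prod_list (map (\<lambda>i. q i j) u)) (partials q u x * letter j)"
  by (induction u)
    (auto simp: partials_Cons tlinear_add[OF tlinear_partial] tlinear_scale[OF tlinear_partial]
      partial_mult_letter tensor.scale_right_distrib mult.commute)

lemma partials_coeff_snoc:
  "partials_coeff q u (w @ [j]) = Poly_Mapping.lookup (partials_cut q j u (basis_tensor w)) []"
  by (simp add: basis_snoc partials_mult_letter lookup_add lookup_tscale lookup_mult_Nil lookup_single)

text \<open>The coefficient vanishes unless \<open>u\<close> is a rearrangement of \<open>w\<close>, and then both products agree.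
The twist gives this without talking about rearrangements: scale \<open>w\<close> before or after applying \<open>\<partial>\<^sub>u\<close>.\<close>

lemma partials_coeff_twist:
  "prod_list (map f u) * partials_coeff q u w = prod_list (map f w) * partials_coeff q u w"
proof -
  have "Poly_Mapping.lookup (partials q u (twist f (basis_tensor w))) []
      = prod_list (map f u) * partials_coeff q u w"
    by (simp only: partials_twist lookup_tscale lookup_twist_Nil)
  then show ?thesis by (simp only: twist_basis tlinear_scale[OF tlinear_partials] lookup_tscale)
qed

text \<open>The cut operators are linear combinations of products of derivations, so a factorization that
holds for all \<open>\<partial>\<^sub>u\<close> holds for them. The outer \<open>\<partial>\<^sub>v\<close> keeps the induction on \<open>u\<close> going: it absorbs the
derivation split off from \<open>u\<close>.\<close>

lemma partials_cut_factor:
  fixes q :: "'i::finite \<Rightarrow> 'i \<Rightarrow> 'k::field"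
  assumes "\<And>u. partials q u x = (\<Sum>w\<in>words (length u). tscale (partials_coeff q u w) (a w))"
  shows "partials q v (partials_cut q j u x)
       = (\<Sum>w | Suc (length w) = length u + length v.
           tscale (Poly_Mapping.lookup (partials q v (partials_cut q j u (basis_tensor w))) []) (a w))"
proof (induction u arbitrary: v)
  case Nil
  then show ?case by (simp add: tlinear_zero[OF tlinear_partials])
next
  case (Cons i u)
  show ?case
    using Cons[of "v @ [i]"] assms[of "v @ u"]
    by (auto simp: tlinear_zero[OF tlinear_partials] tlinear_add[OF tlinear_partials]
        tlinear_scale[OF tlinear_partials] partials_append
        partials_Cons lookup_add lookup_tscale tensor.scale_left_distrib sum.distrib
        tensor.scale_sum_right add.commute)
qed

text \<open>The \<open>a\<^sub>w\<close> are the left components of the coproduct of \<open>x\<close> with right component \<open>w\<close>, and they are the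
same for all \<open>u\<close>. Consequently \<open>\<partial>\<^sub>u x\<close> sees \<open>u\<close> only through the scalars \<open>\<partial>\<^sub>u w\<close>; in particular, a
linear combination of derivations of order \<open>r\<close> that vanishes in degree \<open>r\<close> vanishes everywhere. The
proof builds the coproduct of \<open>v v\<^sub>j\<close> from that of \<open>v\<close>: the new letter joins the right component (\<open>b\<close>)
or the left one (\<open>b'\<close>), where it is braided past the right component.\<close>

lemma partials_factor:
  fixes q :: "'i::finite \<Rightarrow> 'i \<Rightarrow> 'k::field"
  shows "\<exists>a. \<forall>u. partials q u x = (\<Sum>w\<in>words (length u). tscale (partials_coeff q u w) (a w))"
proof (induction x rule: tensor_induct)
  case zero
  show ?case by (auto simp: tlinear_zero[OF tlinear_partials] intro!: exI[of _ "\<lambda>_. 0"])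
next
  case (add x y)
  then obtain a b where
    "\<And>u. partials q u x = (\<Sum>w\<in>words (length u). tscale (partials_coeff q u w) (a w))"
    "\<And>u. partials q u y = (\<Sum>w\<in>words (length u). tscale (partials_coeff q u w) (b w))" by blast
  then show ?case
    by (intro exI[of _ "\<lambda>w. a w + b w"])
      (simp add: tlinear_add[OF tlinear_partials] tensor.scale_right_distrib sum.distrib)
next
  case (basis s v)
  have "\<exists>a. \<forall>u. partials q u (basis_tensor v)
      = (\<Sum>w\<in>words (length u). tscale (partials_coeff q u w) (a w))"
  proof (induction v rule: rev_induct)
    case Nil
    have "partials q u 1 = (\<Sum>w\<in>words (length u).
        tscale (partials_coeff q u w) (if w = [] then 1 else 0))" for u
      by (cases u rule: rev_cases)
        (auto simp: partials_append partials_Cons tlinear_zero[OF tlinear_partials] lookup_one zero_list_def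
          intro!: sum.neutral)
    then show ?case by auto
  next
    case (snoc j v)
    then obtain a where
      a: "partials q u (basis_tensor v) = (\<Sum>w\<in>words (length u). tscale (partials_coeff q u w) (a w))"
      for u by blast
    let ?f = "\<lambda>i. q i j"
    define b where "b w = (if w \<noteq> [] \<and> last w = j then a (butlast w) else 0)" for w
    define b' where "b' w = tscale (prod_list (map ?f w)) (a w * letter j)" for w
    have "partials_cut q j u (basis_tensor v) = (\<Sum>w\<in>words (length u). tscale (partials_coeff q u w) (b w))"
      for u
    proof -
      have "partials_cut q j u (basis_tensor v)
          = (\<Sum>w | Suc (length w) = length u. tscale (partials_coeff q u (w @ [j])) (b (w @ [j])))"
        using partials_cut_factor[OF a, of "[]" j u] by (simp add: partials_coeff_snoc b_def)
      also have "\<dots> = (\<Sum>w\<in>(\<lambda>w. w @ [j]) ` {w. Suc (length w) = length u}.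
            tscale (partials_coeff q u w) (b w))"
        by (simp add: sum.reindex inj_on_def)
      also have "\<dots> = (\<Sum>w\<in>words (length u). tscale (partials_coeff q u w) (b w))"
      proof (intro sum.mono_neutral_left ballI)
        fix w assume w: "w \<in> words (length u) - (\<lambda>w. w @ [j]) ` {w. Suc (length w) = length u}"
        have "w = [] \<or> last w \<noteq> j"
        proof (rule ccontr)
          assume "\<not> (w = [] \<or> last w \<noteq> j)"
          then have "w = butlast w @ [j]" "Suc (length (butlast w)) = length w"
            by (auto simp: append_butlast_last_id)
          then show False using w by auto
        qed
        then show "tscale (partials_coeff q u w) (b w) = 0" by (auto simp: b_def)
      qed auto
      finally show ?thesis .
    qed
    moreover have "tscale (prod_list (map ?f u)) (partials q u (basis_tensor v) * letter j)
        = (\<Sum>w\<in>words (length u). tscale (partials_coeff q u w) (b' w))" for u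
      by (simp add: a sum_distrib_right tscale_mult_left tensor.scale_sum_right b'_def
          partials_coeff_twist mult.commute)
    ultimately have "partials q u (basis_tensor (v @ [j]))
        = (\<Sum>w\<in>words (length u). tscale (partials_coeff q u w) (b w + b' w))" for u
      by (simp add: basis_snoc partials_mult_letter tensor.scale_right_distrib sum.distrib)
    then show ?case by (intro exI[of _ "\<lambda>w. b w + b' w"]) blast
  qed
  then obtain a where
    "\<And>u. partials q u (basis_tensor v) = (\<Sum>w\<in>words (length u). tscale (partials_coeff q u w) (a w))"
    by blast
  then show ?case
    by (intro exI[of _ "\<lambda>w. tscale s (a w)"])
      (simp add: tlinear_scale[OF tlinear_partials] tensor.scale_sum_right tensor.scale_left_commute
        del: tensor.scale_scale)
qed

section \<open>Descent on the order of vanishing\<close>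

text \<open>Extend the matrix to a linear map \<open>M\<close> and take for \<open>g\<close> the matrix of a linear right inverse of \<open>M\<close> onto
its image.\<close>

lemma matrix_generalized_inverse:
  fixes c :: "'i list \<Rightarrow> 'i list \<Rightarrow> 'k::field"
  assumes A: "finite A"
  shows "\<exists>g. \<forall>u\<in>A. \<forall>w\<in>A. (\<Sum>v\<in>A. \<Sum>t\<in>A. c u v * g v t * c t w) = c u w"
proof -
  define M :: "('i, 'k) tensor \<Rightarrow> ('i, 'k) tensor"
    where "M = linear_ext (\<lambda>w. if w \<in> A then \<Sum>u\<in>A. tscale (c u w) (basis_tensor u) else 0)"
  have lin: "tlinear M" unfolding M_def by (rule tlinear_linear_ext)
  interpret vector_space_pair "tscale :: 'k \<Rightarrow> ('i, 'k) tensor \<Rightarrow> _" "tscale :: 'k \<Rightarrow> ('i, 'k) tensor \<Rightarrow> _" ..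
  obtain G where G: "tlinear G" "\<And>x. M (G (M x)) = M x"
    using linear_exists_right_inverse_on[OF lin tensor.subspace_UNIV] by auto
  have Mb: "M (basis_tensor w) = (\<Sum>u\<in>A. tscale (c u w) (basis_tensor u))" if "w \<in> A" for w
    using that by (simp add: M_def)
  have lM: "Poly_Mapping.lookup (M y) u = (\<Sum>v\<in>A. c u v * Poly_Mapping.lookup y v)" if "u \<in> A" for u y
  proof (induction y rule: tensor_induct)
    case (basis s w)
    then show ?case using that A
      by (cases "w \<in> A") (auto simp: tlinear_scale[OF tlinear_linear_ext] M_def lookup_tscale lookup_sum lookup_single
          when_def if_distrib[of "\<lambda>x. _ * x"] mult.commute cong: if_cong)
  qed (simp_all add: tlinear_zero[OF lin] tlinear_add[OF lin] lookup_add distrib_left sum.distrib)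
  show ?thesis
  proof (intro exI[of _ "\<lambda>v t. Poly_Mapping.lookup (G (basis_tensor t)) v"] ballI)
    fix u w assume u: "u \<in> A" and w: "w \<in> A"
    have "c u w = Poly_Mapping.lookup (M (basis_tensor w)) u"
      using A u w by (simp add: lM lookup_single when_def if_distrib[of "\<lambda>x. _ * x"] cong: if_cong)
    also have "\<dots> = Poly_Mapping.lookup (M (G (M (basis_tensor w)))) u" by (simp add: G(2))
    also have "\<dots> = (\<Sum>v\<in>A. \<Sum>t\<in>A. c u v * Poly_Mapping.lookup (G (basis_tensor t)) v * c t w)"
      unfolding lM[OF u] Mb[OF w]
      by (simp add: tlinear_sum[OF G(1)] tlinear_scale[OF G(1)] lookup_sum lookup_tscale
          sum_distrib_left mult.assoc mult.left_commute mult.commute)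
    finally show "(\<Sum>v\<in>A. \<Sum>t\<in>A. c u v * Poly_Mapping.lookup (G (basis_tensor t)) v * c t w) = c u w"
      by simp
  qed
qed

lemma partials_constant_mult:
  assumes "\<And>i. partial q i k = 0"
  shows "partials q u (k * x) = k * partials q u x"
  by (induction u) (simp_all add: partials_Cons partial_mult assms)

text \<open>The leading part of the expansion of \<open>x\<close> with constant coefficients. The linear system
\<open>\<Sum>\<^sub>w (\<partial>\<^sub>u w) k\<^sub>w = \<partial>\<^sub>u x\<close> has the solution \<open>a\<close>, which need not consist of constants; a generalized inverse
applied to the right-hand side, whose entries are constants, gives a solution that does.\<close>

lemma constant_expansion:
  fixes q :: "'i::finite \<Rightarrow> 'i \<Rightarrow> 'k::field"
  assumes x: "x \<in> tensor_power n" and kill: "\<And>u. length u = Suc r \<Longrightarrow> partials q u x = 0"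
  obtains k where "\<And>w. k w \<in> tensor_power (n - r)" "\<And>w i. partial q i (k w) = 0"
    "\<And>u. length u = r \<Longrightarrow> partials q u (x - (\<Sum>w\<in>words r. k w * basis_tensor w)) = 0"
proof -
  let ?c = "partials_coeff q"
  obtain g where g: "\<forall>u\<in>words r. \<forall>w\<in>words r.
      (\<Sum>v\<in>words r. \<Sum>t\<in>words r. ?c u v * g v t * ?c t w) = ?c u w"
    using matrix_generalized_inverse[OF finite_words, of r ?c] by blast
  obtain a where a: "\<And>u. partials q u x = (\<Sum>w\<in>words (length u). tscale (?c u w) (a w))"
    using partials_factor[of q x] by blast
  define k where "k w = (\<Sum>t\<in>words r. tscale (g w t) (partials q t x))" for w
  have kdeg: "k w \<in> tensor_power (n - r)" for w
    unfolding k_def using partials_in_tensor_power[OF x]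
    by (intro tensor_power_sum tensor_power_scale) auto
  have kconst: "partial q i (k w) = 0" for w i
    using kill[of "i # _"]
    by (simp add: k_def tlinear_sum[OF tlinear_partial] tlinear_scale[OF tlinear_partial] flip: partials_Cons)
  have "partials q u (\<Sum>w\<in>words r. k w * basis_tensor w) = partials q u x" if u: "length u = r" for u
  proof -
    have c: "k w * partials q u (basis_tensor w) = tscale (?c u w) (k w)" if "w \<in> words r" for w
    proof -
      have "partials q u (basis_tensor w) \<in> tensor_power 0"
        using u that partials_in_tensor_power[OF basis_in_tensor_power, of w r q u] by simp
      from arg_cong[OF tensor_power_0[OF this], of "(*) (k w)"] show ?thesis
        by (simp only: tscale_mult_right mult_1_right)
    qed
    have "partials q u (\<Sum>w\<in>words r. k w * basis_tensor w)
        = (\<Sum>w\<in>words r. k w * partials q u (basis_tensor w))"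
      by (simp add: tlinear_sum[OF tlinear_partials] partials_constant_mult[OF kconst])
    also have "\<dots> = (\<Sum>v\<in>words r. tscale (?c u v) (k v))"
      by (rule sum.cong[OF refl]) (rule c)
    also have "\<dots> = (\<Sum>v\<in>words r. \<Sum>t\<in>words r. \<Sum>w\<in>words r.
        tscale (?c u v * g v t * ?c t w) (a w))"
      by (simp add: k_def a tensor.scale_sum_right mult.assoc)
    also have "\<dots> = (\<Sum>v\<in>words r. \<Sum>w\<in>words r. \<Sum>t\<in>words r. tscale (?c u v * g v t * ?c t w) (a w))"
      by (intro sum.cong refl sum.swap)
    also have "\<dots> = (\<Sum>w\<in>words r. \<Sum>v\<in>words r. \<Sum>t\<in>words r. tscale (?c u v * g v t * ?c t w) (a w))"
      by (rule sum.swap)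
    also have "\<dots> = (\<Sum>w\<in>words r. tscale (\<Sum>v\<in>words r. \<Sum>t\<in>words r. ?c u v * g v t * ?c t w) (a w))"
      by (simp add: tensor.scale_sum_left)
    also have "\<dots> = partials q u x" using g u by (simp add: a)
    finally show ?thesis .
  qed
  then show ?thesis
    by (intro that[of k] kdeg kconst) (simp add: tlinear_diff[OF tlinear_partials])
qed

text \<open>The radical is an ideal and a subspace containing the generators.\<close>

lemma R_part_subset_derivation_radical:
  fixes q :: "'i::finite \<Rightarrow> 'i \<Rightarrow> 'k::field"
  shows "R_part q m \<subseteq> derivation_radical q"
proof -
  interpret R: ring "ring_of_type_algebra :: ('i, 'k) tensor ring" by (rule ring_tensor)
  have "right_constants q n \<subseteq> derivation_radical q" if "n \<in> {2..m}" for n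
    using that constant_in_derivation_radical[of _ n q] by (auto simp: right_constants_iff)
  then have "right_constants_upto q m \<subseteq> derivation_radical q"
    unfolding right_constants_upto_def
    by (intro tensor.span_minimal subspace_derivation_radical UN_least)
  then have "genideal ring_of_type_algebra (right_constants_upto q m) \<subseteq> derivation_radical q"
    by (intro R.genideal_minimal ideal_derivation_radical)
  then show ?thesis by (auto simp: R_part_def)
qed

text \<open>Induction on the order \<open>r\<close> of vanishing: the leading part of the expansion of \<open>x\<close> lies in the ideal, and
removing it lowers \<open>r\<close>.\<close>

lemma annihilated_in_constants_ideal:
  fixes q :: "'i::finite \<Rightarrow> 'i \<Rightarrow> 'k::field"
  assumes "r \<le> m" "x \<in> tensor_power m" "\<And>u. length u = r \<Longrightarrow> partials q u x = 0"
  shows "x \<in> genideal ring_of_type_algebra (right_constants_upto q m)" (is "_ \<in> ?I")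
  using assms
proof (induction r arbitrary: x)
  case 0
  then show ?case using genideal_tensor(2) by (metis list.size(3) partials_Nil)
next
  case (Suc r)
  obtain k where k: "\<And>w. k w \<in> tensor_power (m - r)" "\<And>w i. partial q i (k w) = 0"
    and kill: "\<And>u. length u = r \<Longrightarrow> partials q u (x - (\<Sum>w\<in>words r. k w * basis_tensor w)) = 0"
    using constant_expansion[OF Suc.prems(2,3)] by blast
  have kI: "k w \<in> ?I" for w
  proof -
    have const: "k w \<in> right_constants q (m - r)" using k by (simp add: right_constants_iff)
    \<comment> \<open>Coefficients of degree 1 are not among the generators, but there are no constants of
      degree 1 except 0, as \<open>T\<^sub>1 = id\<close>.\<close>
    show ?thesis
    proof (cases "m - r = 1")
      case True
      have "k w = 0"
        using const by (simp add: right_constants_def right_diff_def True)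
      then show ?thesis by (simp add: genideal_tensor(2))
    next
      case False
      then have "m - r \<in> {2..m}" using Suc.prems(1) by auto
      then have "k w \<in> right_constants_upto q m"
        unfolding right_constants_upto_def using const by (intro tensor.span_base) blast
      then show ?thesis using genideal_tensor(1) by blast
    qed
  qed
  let ?y = "\<Sum>w\<in>words r. k w * basis_tensor w"
  have y: "?y \<in> ?I"
    using finite_words[of r]
    by (induction rule: finite_induct) (simp_all add: genideal_tensor kI)
  have "k w * basis_tensor w \<in> tensor_power m" if "w \<in> words r" for w
    using tensor_power_mult[OF k(1) basis_in_tensor_power[of w r]] that Suc.prems(1) by simp
  then have "x - ?y \<in> tensor_power m"
    by (intro tensor_power_diff Suc.prems(2) tensor_power_sum)
  then have "x - ?y \<in> ?I" using Suc.IH kill Suc.prems(1) by simp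
  then have "(x - ?y) + ?y \<in> ?I" using y by (rule genideal_tensor(3))
  then show ?case by simp
qed

theorem theorem1:
  fixes q :: "'i::finite \<Rightarrow> 'i \<Rightarrow> 'k::field_char_0"
    and m :: nat
  assumes "\<And>i j. q i j \<noteq> 0"
    and "m \<ge> 2"
  shows "R_part q m = {x \<in> tensor_power m. total_symm q m x = 0}"
proof (intro subset_antisym subsetI)
  fix x assume x: "x \<in> R_part q m"
  then have deg: "x \<in> tensor_power m" by (simp add: R_part_def)
  have "partials q u x = 0" if "length u = m" for u
  proof -
    have "partials q u x \<in> tensor_power 0" using partials_in_tensor_power[OF deg, of q u] that by simp
    moreover have "Poly_Mapping.lookup (partials q u x) [] = 0"
      using x R_part_subset_derivation_radical[of q m] by (auto simp: derivation_radical_def)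
    ultimately show ?thesis using tensor_power_0 by (metis tensor.scale_zero_left)
  qed
  then show "x \<in> {x \<in> tensor_power m. total_symm q m x = 0}"
    using deg by (simp add: total_symm_eq_0_iff)
next
  fix x assume "x \<in> {x \<in> tensor_power m. total_symm q m x = 0}"
  then have x: "x \<in> tensor_power m" "\<And>u. length u = m \<Longrightarrow> partials q u x = 0"
    by (auto simp: total_symm_eq_0_iff)
  then show "x \<in> R_part q m"
    using annihilated_in_constants_ideal[OF order_refl x] by (simp add: R_part_def)
qed

end
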